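(* There is an absolute constant $C$ such that for every $f\in X^{0,\frac13}(\mathbb{T}^2)$, $$\|f\|_{L^4_{x,t}(\mathbb{T}^2)}\le C\,\|f\|_{X^{0,\frac13}(\mathbb{T}^2)}.$$
   Context: $\mathbb{T}^2=[0,2\pi]_x\times[0,2\pi]_t$ with endpoints identified in each variable; for $f$ on $\mathbb{T}^2$, $\widehat f(n,\tau)$, $(n,\tau)\in\mathbb{Z}^2$, denotes its space-time Fourier coefficients. Let $P(n)=n^3-2n^2+8n$ (the dispersion relation of the linearized periodic Dysthe equation) and $\langle y\rangle=1+|y|$. The Bourgain space $X^{s,b}$ is defined by the norm $$\|f\|_{X^{s,b}}=\Big(\sum_{n\in\mathbb{Z}}\langle n\rangle^{2s}\sum_{\tau\in\mathbb{Z}}\langle\tau-P(n)\rangle^{2b}|\widehat f(n,\tau)|^2\Big)^{1/2}.$$ *)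

theory Defs
  imports "HOL-Analysis.Analysis"
begin

text \<open>
  A function on the torus is represented by a function of \<open>(x, t)\<close> that is looked at only on
  the square \<open>[0, 2\<pi>] \<times> [0, 2\<pi>]\<close>, up to Lebesgue null sets. The endpoint identification therefore
  imposes no condition: it concerns only the boundary of the square, which is null.
\<close>

definition torus :: "(real \<times> real) measure" where
  "torus = lebesgue_on ({0..2 * pi} \<times> {0..2 * pi})"

definition fourier_coeff :: "(real \<times> real \<Rightarrow> complex) \<Rightarrow> int \<Rightarrow> int \<Rightarrow> complex" where
  "fourier_coeff f n \<tau> =
     (\<integral>z. f z * exp (- \<i> * complex_of_real (of_int n * fst z + of_int \<tau> * snd z)) \<partial>torus)
       / complex_of_real ((2 * pi)\<^sup>2)"

definition Lp_space :: "real \<Rightarrow> (real \<times> real \<Rightarrow> complex) set" where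
  "Lp_space p = {f \<in> borel_measurable torus. integrable torus (\<lambda>z. norm (f z) powr p)}"

definition Lp_norm :: "real \<Rightarrow> (real \<times> real \<Rightarrow> complex) \<Rightarrow> real" where
  "Lp_norm p f = (\<integral>z. norm (f z) powr p \<partial>torus) powr (1 / p)"

definition dispersion :: "int \<Rightarrow> int" where
  "dispersion n = n ^ 3 - 2 * n ^ 2 + 8 * n"

definition bracket :: "int \<Rightarrow> real" where
  "bracket y = 1 + \<bar>of_int y\<bar>"

text \<open>
  Integrability on the torus is what gives the Fourier coefficients a meaning. For \<open>s, b \<ge> 0\<close> it
  excludes nothing: a periodic distribution of finite norm then has square-summable
  coefficients, so it is a square-integrable function. The terms are nonnegative, so summability
  over pairs says precisely that the iterated sum in the norm below is finite.
\<close>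

definition bourgain_space :: "real \<Rightarrow> real \<Rightarrow> (real \<times> real \<Rightarrow> complex) set" where
  "bourgain_space s b = {f. integrable torus f \<and>
     (\<lambda>(n, \<tau>). bracket n powr (2 * s) * (bracket (\<tau> - dispersion n) powr (2 * b)
        * (norm (fourier_coeff f n \<tau>))\<^sup>2)) summable_on UNIV}"

definition bourgain_norm :: "real \<Rightarrow> real \<Rightarrow> (real \<times> real \<Rightarrow> complex) \<Rightarrow> real" where
  "bourgain_norm s b f =
     sqrt (\<Sum>\<^sub>\<infinity>n. bracket n powr (2 * s) *
       (\<Sum>\<^sub>\<infinity>\<tau>. bracket (\<tau> - dispersion n) powr (2 * b) * (norm (fourier_coeff f n \<tau>))\<^sup>2))"

end

theory Submission
  imports Defs
begin

text \<open>
  For a trigonometric polynomial \<open>g\<close>, Parseval applied to \<open>g\<^sup>2\<close> turns the \<open>L\<^sup>4\<close> bound into an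
  \<open>\<ell>\<^sup>2\<close> bound for the convolution square of the absolute values of its coefficients. By symmetry
  the first of the two interacting frequencies may carry the larger modulation \<open>L\<close>; let \<open>l\<close> be the
  smaller one and \<open>N\<close> the bracket of the output spatial frequency \<open>n\<close>. If \<open>L \<le> N ^ 3\<close>, then
  Cauchy--Schwarz suffices, because \<open>P m + P (n - m)\<close> is quadratic in \<open>m\<close> with leading coefficient
  \<open>3 n - 4\<close>, comparable to \<open>N\<close>. If \<open>L > N ^ 3\<close>, then the weights are at most
  \<open>l powr (- 1/3) * max l (N ^ 3) powr (- 1/3)\<close>, a Hilbert-type kernel in \<open>l powr (1/3)\<close> and \<open>N\<close> that
  a weighted Schur test controls, whereas unweighted Cauchy--Schwarz loses a logarithm.

  A general \<open>f\<close> is the almost everywhere limit of a subsequence of partial sums of its Fourier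
  series: these are Cauchy in \<open>L\<^sup>1\<close>, and the limit is \<open>f\<close> since an integrable function with
  vanishing Fourier coefficients is zero. Fatou's lemma concludes.
\<close>

subsection \<open>Weighted sums over the integers\<close>

text \<open>The mean value theorem on \<open>[x, x + 1]\<close> for the power \<open>1 - a\<close>,
  whose derivative decreases, compares one summand with an integral over a unit interval. The point
  \<open>x = 0\<close> is separate because the power is not differentiable there.\<close>

lemma powr_minus_le_diff_low:
  fixes a x :: real
  assumes "0 < a" "a < 1" "0 \<le> x"
  shows "(1 - a) * (x + 1) powr (- a) \<le> (x + 1) powr (1 - a) - x powr (1 - a)"
proof (cases "x = 0")
  case True
  then show ?thesis using assms by simp
next
  case False
  then have "x > 0" using assms by simp
  then have "\<exists>z::real. z > x \<and> z < x + 1 \<and> (x + 1) powr (1 - a) - x powr (1 - a) = (x + 1 - x) * ((1 - a) * z powr (1 - a - 1))"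
    by (intro MVT2) (auto intro!: derivative_eq_intros)
  then obtain z where z: "z > x" "z < x + 1" "(x + 1) powr (1 - a) - x powr (1 - a) = (1 - a) * z powr (- a)"
    by auto
  have "(x + 1) powr (- a) \<le> z powr (- a)"
    using z \<open>x > 0\<close> assms by (intro powr_mono2') auto
  then show ?thesis using z assms by (simp add: mult_left_mono)
qed

lemma powr_minus_le_diff_high:
  fixes b x :: real
  assumes "1 < b" "0 < x"
  shows "(b - 1) * (x + 1) powr (- b) \<le> x powr (1 - b) - (x + 1) powr (1 - b)"
proof -
  have "\<exists>z::real. z > x \<and> z < x + 1 \<and> (x + 1) powr (1 - b) - x powr (1 - b) = (x + 1 - x) * ((1 - b) * z powr (1 - b - 1))"
    using assms by (intro MVT2) (auto intro!: derivative_eq_intros)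
  then obtain z where z: "z > x" "z < x + 1" "(x + 1) powr (1 - b) - x powr (1 - b) = (1 - b) * z powr (- b)"
    by auto
  have "(x + 1) powr (- b) \<le> z powr (- b)"
    using z assms by (intro powr_mono2') auto
  then have "(b - 1) * (x + 1) powr (- b) \<le> (b - 1) * z powr (- b)"
    using assms by (simp add: mult_left_mono)
  then show ?thesis using z by (simp add: algebra_simps)
qed

lemma sum_powr_low:
  fixes a :: real
  assumes "0 < a" "a < 1"
  shows "(\<Sum>l=1..M. real l powr (- a)) \<le> real M powr (1 - a) / (1 - a)"
proof (induction M)
  case (Suc M)
  have "(1 - a) * (real M + 1) powr (- a) \<le> (real M + 1) powr (1 - a) - real M powr (1 - a)"
    using assms by (intro powr_minus_le_diff_low) auto
  then have "(real M + 1) powr (- a) \<le> (real M + 1) powr (1 - a) / (1 - a) - real M powr (1 - a) / (1 - a)"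
    using assms by (simp add: pos_le_divide_eq mult.commute flip: diff_divide_distrib)
  then show ?case using Suc by (simp add: add.commute)
qed simp

text \<open>Telescoping of \<open>powr_minus_le_diff_high\<close>; the subtracted end term is kept
  because the induction needs it.\<close>

lemma sum_powr_high:
  fixes b :: real
  assumes "1 < b" "0 < M"
  shows "(\<Sum>l=M+1..M+K. real l powr (- b)) \<le> (real M powr (1 - b) - real (M + K) powr (1 - b)) / (b - 1)"
proof (induction K)
  case (Suc K)
  have "(b - 1) * (real (M + K) + 1) powr (- b) \<le> real (M + K) powr (1 - b) - (real (M + K) + 1) powr (1 - b)"
    using assms by (intro powr_minus_le_diff_high) auto
  then have "(real (M + K) + 1) powr (- b) \<le> (real (M + K) powr (1 - b) - (real (M + K) + 1) powr (1 - b)) / (b - 1)"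
    using assms by (simp add: field_simps)
  then show ?case using Suc by (simp add: add.commute add.left_commute diff_divide_distrib)
qed simp

text \<open>Below \<open>R\<close> the kernel is \<open>R powr (a - b) * l powr (- a)\<close>, above
  it is \<open>l powr (- b)\<close>. Since \<open>a < 1 < b\<close>, both sums are governed by their
  end at \<open>R\<close> and have size \<open>R powr (1 - b)\<close>.\<close>

lemma kernel_sum_nat:
  fixes a b R :: real
  assumes a: "0 < a" "a < 1" and b: "1 < b" and R: "1 \<le> R"
  shows "(\<Sum>l=1..n. real l powr (- a) * max (real l) R powr (a - b))
    \<le> (1 / (1 - a) + 2 powr (b - 1) / (b - 1)) * R powr (1 - b)"
proof -
  define M where "M = nat \<lfloor>R\<rfloor>"
  have M: "0 < M" "real M \<le> R" "R < real M + 1"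
    using R unfolding M_def by linarith+
  \<comment> \<open>Replacing \<open>M\<close> by \<open>R / 2\<close> in the decreasing power
    \<open>1 - b\<close> later costs the factor \<open>2 powr (b - 1)\<close>.\<close>
  then have M2: "R \<le> 2 * real M" by linarith
  let ?h = "\<lambda>l. real l powr (- a) * max (real l) R powr (a - b)"
  \<comment> \<open>Going up to \<open>M + n\<close> permits a cut at \<open>M\<close> even when
    \<open>n < M\<close>.\<close>
  have "(\<Sum>l=1..n. ?h l) \<le> (\<Sum>l=1..M+n. ?h l)"
    by (intro sum_mono2) auto
  also have "{1..M+n} = {1..M} \<union> {M+1..M+n}" by auto
  also have "(\<Sum>l\<in>\<dots>. ?h l) = (\<Sum>l=1..M. ?h l) + (\<Sum>l=M+1..M+n. ?h l)"
    by (intro sum.union_disjoint) auto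
  also have "(\<Sum>l=1..M. ?h l) = R powr (a - b) * (\<Sum>l=1..M. real l powr (- a))"
    unfolding sum_distrib_left using M by (intro sum.cong) (auto simp: max_def)
  also have "\<dots> \<le> R powr (a - b) * (real M powr (1 - a) / (1 - a))"
    using sum_powr_low[OF a] by (intro mult_left_mono) auto
  also have "\<dots> \<le> R powr (a - b) * (R powr (1 - a) / (1 - a))"
    using a M by (intro mult_left_mono divide_right_mono powr_mono2) auto
  also have "\<dots> = 1 / (1 - a) * R powr (1 - b)"
    using R by (simp add: powr_add[symmetric])
  also have "(\<Sum>l=M+1..M+n. ?h l) = (\<Sum>l=M+1..M+n. real l powr (- b))"
    using M by (intro sum.cong) (auto simp: max_def powr_add[symmetric])
  also have "\<dots> \<le> (real M powr (1 - b) - real (M + n) powr (1 - b)) / (b - 1)"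
    using sum_powr_high[OF b M(1)] .
  also have "\<dots> \<le> real M powr (1 - b) / (b - 1)"
    using b by (intro divide_right_mono) auto
  also have "\<dots> \<le> (R / 2) powr (1 - b) / (b - 1)"
    using b M M2 R by (intro divide_right_mono powr_mono2') auto
  also have "\<dots> = 2 powr (b - 1) / (b - 1) * R powr (1 - b)"
    using R powr_minus_divide[of 2 "1 - b"] by (simp add: powr_divide)
  finally show ?thesis by (simp add: algebra_simps)
qed

text \<open>Each value of \<open>bracket\<close> is taken at most twice, once on each half-line,
  where \<open>abs\<close> is injective.\<close>

lemma sum_int_le_sum_nat:
  fixes h :: "real \<Rightarrow> real"
  assumes "finite F" "\<And>x. h x \<ge> 0" "\<And>n. (\<Sum>l=1..n. h (real l)) \<le> B"
  shows "(\<Sum>m\<in>F. h (bracket m)) \<le> 2 * B"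
proof -
  define n where "n = nat (Max ((\<lambda>m. \<bar>m\<bar>) ` insert 0 F)) + 1"
  have n: "nat \<bar>m\<bar> + 1 \<in> {1..n}" if "m \<in> F" for m
  proof -
    have "\<bar>m\<bar> \<le> Max ((\<lambda>m. \<bar>m\<bar>) ` insert 0 F)"
      using assms(1) that by (intro Max_ge) auto
    then show ?thesis unfolding n_def by auto
  qed
  have half: "(\<Sum>m\<in>G. h (bracket m)) \<le> B" if "G \<subseteq> F" "inj_on abs G" for G
  proof -
    have inj: "inj_on (\<lambda>m::int. nat \<bar>m\<bar> + 1) G"
      using that(2) by (auto simp: inj_on_def)
    have "(\<Sum>m\<in>G. h (bracket m)) = (\<Sum>m\<in>G. h (real (nat \<bar>m\<bar> + 1)))"
      by (intro sum.cong) (auto simp: bracket_def add.commute)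
    also have "\<dots> = (\<Sum>l\<in>(\<lambda>m. nat \<bar>m\<bar> + 1) ` G. h (real l))"
      by (subst sum.reindex[OF inj]) (simp add: o_def)
    also have "\<dots> \<le> (\<Sum>l=1..n. h (real l))"
      using n that assms by (intro sum_mono2) auto
    finally show ?thesis using assms(3)[of n] by linarith
  qed
  have "F = {m\<in>F. m \<ge> 0} \<union> {m\<in>F. m < 0}" by auto
  then have "(\<Sum>m\<in>F. h (bracket m)) = (\<Sum>m\<in>{m\<in>F. m \<ge> 0}. h (bracket m)) + (\<Sum>m\<in>{m\<in>F. m < 0}. h (bracket m))"
    using assms(1) by (subst sum.union_disjoint[symmetric]) auto
  moreover have "(\<Sum>m\<in>{m\<in>F. m \<ge> 0}. h (bracket m)) \<le> B" by (rule half) (auto simp: inj_on_def)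
  moreover have "(\<Sum>m\<in>{m\<in>F. m < 0}. h (bracket m)) \<le> B" by (rule half) (auto simp: inj_on_def)
  ultimately show ?thesis by linarith
qed

definition kernel_const :: "real \<Rightarrow> real \<Rightarrow> real" where
  "kernel_const a b = 2 * (1 / (1 - a) + 2 powr (b - 1) / (b - 1))"

lemma kernel_sum:
  fixes a b R :: real
  assumes "finite F" "0 < a" "a < 1" "1 < b" "1 \<le> R"
  shows "(\<Sum>m\<in>F. bracket m powr (- a) * max (bracket m) R powr (a - b)) \<le> kernel_const a b * R powr (1 - b)"
proof -
  have "(\<Sum>m\<in>F. bracket m powr (- a) * max (bracket m) R powr (a - b))
      \<le> 2 * ((1 / (1 - a) + 2 powr (b - 1) / (b - 1)) * R powr (1 - b))"
    using kernel_sum_nat[OF assms(2-5)]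
    by (intro sum_int_le_sum_nat[where h = "\<lambda>x. x powr (- a) * max x R powr (a - b)"] assms(1)) auto
  then show ?thesis by (simp only: kernel_const_def mult.assoc)
qed

lemma kernel_sum_shift:
  fixes a b R :: real
  assumes "finite F" "0 < a" "a < 1" "1 < b" "1 \<le> R" "inj_on s F"
  shows "(\<Sum>m\<in>F. bracket (s m) powr (- a) * max (bracket (s m)) R powr (a - b)) \<le> kernel_const a b * R powr (1 - b)"
  using kernel_sum[of "s ` F" a b R] assms by (simp add: sum.reindex o_def)

lemma bracket_ge_1: "1 \<le> bracket m"
  by (simp add: bracket_def)

lemma bracket_pos: "0 < bracket m"
  by (simp add: bracket_def)

lemma kernel_const_nonneg: "a < 1 \<Longrightarrow> 1 < b \<Longrightarrow> 0 \<le> kernel_const a b"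
  by (simp add: kernel_const_def)

section \<open>Sums of inverse powers of a quadratic resonance function\<close>

definition quad_const :: real where
  "quad_const = 3 + 432 powr (1/3) * kernel_const (2/3) (4/3)"

text \<open>On \<open>d \<ge> 0\<close> the quadratic has at most one root \<open>r\<close>, and a
  term at distance \<open>x\<close> from it is of order
  \<open>(N * x\<^sup>2) powr (- (1/3))\<close>. The size hypothesis confines \<open>x\<close> to a
  multiple of \<open>N\<close>, so the sum of \<open>x powr (- (2/3))\<close> is of order
  \<open>N powr (1/3)\<close> and cancels the prefactor: the bound is uniform in \<open>N\<close>
  and \<open>a\<close>.\<close>

lemma quad_sum_half:
  fixes N a :: real
  assumes "finite G" "1 \<le> N" and G: "\<And>d. d \<in> G \<Longrightarrow> 0 \<le> d \<and> N / 8 * \<bar>(of_int d)\<^sup>2 - a\<bar> \<le> 2 * N ^ 3"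
  shows "(\<Sum>d\<in>G. (1 + N / 8 * \<bar>(of_int d)\<^sup>2 - a\<bar>) powr (- (1/3))) \<le> quad_const"
proof -
  \<comment> \<open>For \<open>a < 0\<close> there is no root; then \<open>r = 0\<close> works, as
    the distance from \<open>(of_int d)\<^sup>2\<close> to \<open>a\<close> is at least
    \<open>(of_int d)\<^sup>2\<close>.\<close>
  define r where "r = sqrt (max a 0)"
  define q where "q = \<lfloor>r\<rfloor>"
  \<comment> \<open>The size hypothesis gives a distance of at most \<open>4 * N + 1\<close> from
    \<open>q\<close>, hence a bracket of at most \<open>4 * N + 2 \<le> 6 * N\<close>.\<close>
  define R where "R = 6 * N"
  have r: "0 \<le> r" by (simp add: r_def)
  have R: "1 \<le> R" using assms by (simp add: R_def)
  let ?E = "\<lambda>d::int. 1 + N / 8 * \<bar>(of_int d)\<^sup>2 - a\<bar>"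
  let ?k = "\<lambda>d. bracket (d - q) powr (- (2/3)) * max (bracket (d - q)) R powr (2/3 - 4/3)"
  \<comment> \<open>The three integers nearest \<open>q\<close> are bounded by 1 each. Elsewhere the
    distance to \<open>q\<close> is at least 2, so that even after losing 1 to the floor it stays
    above a third of the bracket.\<close>
  have pt: "?E d powr (- (1/3)) \<le> (if d \<in> {q-1..q+1} then 1 else 0) + 432 powr (1/3) * R powr (1/3) * ?k d" if "d \<in> G" for d
  proof (cases "d \<in> {q-1..q+1}")
    case True
    have "?E d powr (- (1/3)) \<le> 1 powr (- (1/3))"
      using assms by (intro powr_mono2') auto
    moreover have "0 \<le> 432 powr (1/3) * R powr (1/3) * ?k d" by simp
    ultimately have "?E d powr (- (1/3)) \<le> 1 + 432 powr (1/3) * R powr (1/3) * ?k d"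
      by (intro add_increasing2) auto
    then show ?thesis using True by simp
  next
    case False
    then have m: "\<bar>d - q\<bar> \<ge> 2" by auto
    have d: "0 \<le> d" "N / 8 * \<bar>(of_int d)\<^sup>2 - a\<bar> \<le> 2 * N ^ 3" using G[OF that] by auto
    have sq: "(of_int d - r)\<^sup>2 \<le> \<bar>(of_int d)\<^sup>2 - a\<bar>"
    proof (cases "a \<ge> 0")
      case True
      then have "a = r\<^sup>2" by (simp add: r_def)
      then have "\<bar>(of_int d)\<^sup>2 - a\<bar> = \<bar>of_int d - r\<bar> * (of_int d + r)"
        using d r by (simp add: power2_eq_square square_diff_square_factored abs_mult)
      moreover have "\<bar>of_int d - r\<bar> * \<bar>of_int d - r\<bar> \<le> \<bar>of_int d - r\<bar> * (of_int d + r)"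
        using d r by (intro mult_left_mono) auto
      ultimately show ?thesis by (simp add: power2_eq_square)
    next
      case False
      then show ?thesis by (simp add: r_def)
    qed
    have "real_of_int \<bar>d - q\<bar> - 1 \<le> \<bar>of_int d - r\<bar>"
      unfolding q_def by linarith
    have N2: "0 \<le> real_of_int \<bar>d - q\<bar> - 1" using m by linarith
    have near: "real_of_int \<bar>d - q\<bar> - 1 \<le> 4 * N"
    proof (rule power2_le_imp_le)
      have "N / 8 * (real_of_int \<bar>d - q\<bar> - 1)\<^sup>2 \<le> N / 8 * (of_int d - r)\<^sup>2"
        using \<open>real_of_int \<bar>d - q\<bar> - 1 \<le> \<bar>of_int d - r\<bar>\<close> N2 assms
        by (intro mult_left_mono) (auto simp: abs_le_square_iff[symmetric])
      also have "\<dots> \<le> N / 8 * \<bar>(of_int d)\<^sup>2 - a\<bar>"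
        using assms sq by (intro mult_left_mono) auto
      also have "\<dots> \<le> N / 8 * (4 * N)\<^sup>2" using d by (simp add: power_def eval_nat_numeral)
      finally show "(real_of_int \<bar>d - q\<bar> - 1)\<^sup>2 \<le> (4 * N)\<^sup>2"
        using assms by simp
    qed (use assms in simp)
    then have bR: "bracket (d - q) \<le> R"
      using assms by (simp add: bracket_def R_def)
    have "bracket (d - q) / 3 \<le> real_of_int \<bar>d - q\<bar> - 1"
      using m by (simp add: bracket_def)
    also have "\<dots> \<le> \<bar>of_int d - r\<bar>" by fact
    finally have "(bracket (d - q) / 3)\<^sup>2 \<le> (of_int d - r)\<^sup>2"
      by (simp add: abs_le_square_iff[symmetric] bracket_def)
    then have "N / 8 * (bracket (d - q) / 3)\<^sup>2 \<le> N / 8 * \<bar>(of_int d)\<^sup>2 - a\<bar>"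
      using sq assms by (intro mult_left_mono) auto
    \<comment> \<open>\<open>N / 8 = R / 48\<close>, and the squared third of the bracket gives
      \<open>48 * 9 = 432\<close>.\<close>
    then have lower: "R * (bracket (d - q))\<^sup>2 / 432 \<le> ?E d"
      by (simp add: R_def power_divide)
    have pos: "R * (bracket (d - q))\<^sup>2 / 432 > 0" using R bracket_pos[of "d - q"] by simp
    have "?E d powr (- (1/3)) \<le> (R * (bracket (d - q))\<^sup>2 / 432) powr (- (1/3))"
      using lower pos by (intro powr_mono2') auto
    also have "\<dots> = 432 powr (1/3) * R powr (- (1/3)) * bracket (d - q) powr (- (2/3))"
      using R bracket_pos[of "d - q"]
      by (simp add: powr_divide powr_mult powr_minus field_simps powr_powr flip: powr_numeral)
    \<comment> \<open>The bracket is at most \<open>R\<close>, so the maximum equals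
      \<open>R\<close>; written this way, the truncated sum becomes an instance of
      \<open>kernel_sum_shift\<close>.\<close>
    also have "R powr (- (1/3)) = R powr (1/3) * max (bracket (d - q)) R powr (2/3 - 4/3)"
      using bR R by (simp add: max_def powr_add[symmetric])
    finally show ?thesis using False by (simp add: mult_ac)
  qed
  have "(\<Sum>d\<in>G. ?E d powr (- (1/3))) \<le> (\<Sum>d\<in>G. (if d \<in> {q-1..q+1} then 1 else 0) + 432 powr (1/3) * R powr (1/3) * ?k d)"
    by (intro sum_mono pt)
  also have "\<dots> = (\<Sum>d\<in>G. if d \<in> {q-1..q+1} then 1 else 0) + 432 powr (1/3) * R powr (1/3) * (\<Sum>d\<in>G. ?k d)"
    by (simp add: sum.distrib sum_distrib_left)
  also have "\<dots> \<le> 3 + 432 powr (1/3) * R powr (1/3) * (kernel_const (2/3) (4/3) * R powr (1 - 4/3))"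
  proof (intro add_mono mult_left_mono)
    have "card (G \<inter> {q-1..q+1}) \<le> card {q-1..q+1}"
      by (intro card_mono) auto
    moreover have "(\<Sum>d\<in>G. if d \<in> {q-1..q+1} then 1 else 0) = real (card (G \<inter> {q-1..q+1}))"
      using assms(1) by (simp only: sum.inter_restrict[symmetric]) simp
    ultimately show "(\<Sum>d\<in>G. if d \<in> {q-1..q+1} then 1 else 0) \<le> (3::real)" by simp
    show "(\<Sum>d\<in>G. ?k d) \<le> kernel_const (2/3) (4/3) * R powr (1 - 4/3)"
      using assms R by (intro kernel_sum_shift) (auto simp: inj_on_def)
  qed auto
  also have "\<dots> = quad_const"
    using R by (simp add: powr_add[symmetric] quad_const_def)
  finally show ?thesis .
qed

lemma quad_sum:
  fixes N a :: real
  assumes "finite G" "1 \<le> N" and G: "\<And>d. d \<in> G \<Longrightarrow> N / 8 * \<bar>(of_int d)\<^sup>2 - a\<bar> \<le> 2 * N ^ 3"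
  shows "(\<Sum>d\<in>G. (1 + N / 8 * \<bar>(of_int d)\<^sup>2 - a\<bar>) powr (- (1/3))) \<le> 2 * quad_const"
proof -
  let ?h = "\<lambda>d::int. (1 + N / 8 * \<bar>(of_int d)\<^sup>2 - a\<bar>) powr (- (1/3))"
  have "G = {d\<in>G. d \<ge> 0} \<union> {d\<in>G. d < 0}" by auto
  then have "sum ?h G = sum ?h {d\<in>G. d \<ge> 0} + sum ?h {d\<in>G. d < 0}"
    using assms(1) by (subst sum.union_disjoint[symmetric]) auto
  moreover have "sum ?h {d\<in>G. d \<ge> 0} \<le> quad_const"
    using assms by (intro quad_sum_half) auto
  moreover have "sum ?h {d\<in>G. d < 0} = sum ?h (uminus ` {d\<in>G. d < 0})"
    by (subst sum.reindex) (auto simp: inj_on_def)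
  moreover have "sum ?h (uminus ` {d\<in>G. d < 0}) \<le> quad_const"
    using assms by (intro quad_sum_half) auto
  ultimately show ?thesis by linarith
qed

text \<open>\<open>P m + P (n - m) - P n = - (3 * n - 4) * m * (n - m)\<close>, with the square
  completed; the factor 4 keeps everything in the integers.\<close>

lemma dispersion_resonance:
  "4 * (dispersion m + dispersion (n - m))
    = 4 * dispersion n - (3 * n - 4) * (n\<^sup>2 - (2 * m - n)\<^sup>2)"
  unfolding dispersion_def by algebra

text \<open>In the variable \<open>d = 2 * m - n\<close> the argument of \<open>D m\<close> is
  \<open>(4 - 3 * n) / 4\<close> times \<open>d\<^sup>2 - a\<close>, which reduces the claim to
  \<open>quad_sum\<close>.\<close>

lemma resonance_sum:
  fixes n t :: int
  defines "D \<equiv> \<lambda>m. bracket (t - dispersion m - dispersion (n - m))"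
  assumes "finite F" and F: "\<And>m. m \<in> F \<Longrightarrow> D m \<le> 2 * bracket n ^ 3"
  shows "(\<Sum>m\<in>F. D m powr (- (1/3))) \<le> 2 * quad_const"
proof -
  define N where "N = bracket n"
  \<comment> \<open>The value of \<open>d\<^sup>2\<close> at which the completed square
    vanishes.\<close>
  define a where "a = (of_int n)\<^sup>2 - 4 * (of_int (t - dispersion n)) / (4 - 3 * of_int n :: real)"
  have N: "1 \<le> N" by (simp add: N_def bracket_ge_1)
  \<comment> \<open>The leading coefficient has no integer zero; equality holds at
    \<open>n = 1\<close>. With the 4 from \<open>dispersion_resonance\<close>, this gives the factor
    \<open>N / 8\<close>.\<close>
  have "\<bar>3 * n - 4\<bar> * 2 \<ge> 1 + \<bar>n\<bar>" by presburger
  then have "real_of_int (\<bar>3 * n - 4\<bar> * 2) \<ge> real_of_int (1 + \<bar>n\<bar>)" by linarith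
  then have q: "\<bar>4 - 3 * real_of_int n\<bar> \<ge> N / 2" by (simp add: N_def bracket_def abs_minus_commute)
  have lower: "1 + N / 8 * \<bar>(of_int (2 * m - n))\<^sup>2 - a\<bar> \<le> D m" for m
  proof -
    let ?d = "real_of_int (2 * m - n)"
    have nz: "4 - 3 * real_of_int n \<noteq> 0" using q N by auto
    have "4 * (t - dispersion m - dispersion (n - m))
       = 4 * (t - dispersion n) + (3 * n - 4) * (n\<^sup>2 - (2 * m - n)\<^sup>2)"
      using dispersion_resonance[of m n] by algebra
    then have "real_of_int (4 * (t - dispersion m - dispersion (n - m)))
       = real_of_int (4 * (t - dispersion n) + (3 * n - 4) * (n\<^sup>2 - (2 * m - n)\<^sup>2))"
      by (rule arg_cong)
    also have "\<dots> = (4 - 3 * of_int n) * (?d\<^sup>2 - a)"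
      using nz by (simp add: a_def field_simps)
    finally have eq: "real_of_int (4 * (t - dispersion m - dispersion (n - m))) = (4 - 3 * of_int n) * (?d\<^sup>2 - a)" .
    have "4 * \<bar>real_of_int (t - dispersion m - dispersion (n - m))\<bar> = \<bar>4 - 3 * real_of_int n\<bar> * \<bar>?d\<^sup>2 - a\<bar>"
      using arg_cong[OF eq, of abs] by (simp only: of_int_mult abs_mult of_int_numeral abs_numeral)
    moreover have "N / 2 * \<bar>?d\<^sup>2 - a\<bar> \<le> \<bar>4 - 3 * real_of_int n\<bar> * \<bar>?d\<^sup>2 - a\<bar>"
      using q by (intro mult_right_mono) auto
    ultimately show ?thesis by (simp add: D_def bracket_def)
  qed
  have inj: "inj_on (\<lambda>m. 2 * m - n) F" by (auto simp: inj_on_def)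
  have "(\<Sum>m\<in>F. D m powr (- (1/3))) \<le> (\<Sum>m\<in>F. (1 + N / 8 * \<bar>(of_int (2 * m - n))\<^sup>2 - a\<bar>) powr (- (1/3)))"
    using lower N by (intro sum_mono powr_mono2') (auto intro: add_pos_nonneg)
  also have "\<dots> = (\<Sum>d\<in>(\<lambda>m. 2 * m - n) ` F. (1 + N / 8 * \<bar>(of_int d)\<^sup>2 - a\<bar>) powr (- (1/3)))"
    by (subst sum.reindex[OF inj]) simp
  also have "\<dots> \<le> 2 * quad_const"
  proof (intro quad_sum)
    fix d assume "d \<in> (\<lambda>m. 2 * m - n) ` F"
    then obtain m where m: "m \<in> F" "d = 2 * m - n" by auto
    show "N / 8 * \<bar>(of_int d)\<^sup>2 - a\<bar> \<le> 2 * N ^ 3"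
      using lower[of m] F[OF m(1)] m(2) by (simp add: N_def)
  qed (use assms N in auto)
  finally show ?thesis .
qed

subsection \<open>Sums over interacting frequencies\<close>

definition modulation :: "int \<times> int \<Rightarrow> real" where
  "modulation k = bracket (snd k - dispersion (fst k))"

lemma modulation_ge_1: "1 \<le> modulation k"
  by (simp add: modulation_def bracket_ge_1)

lemma modulation_pos: "0 < modulation k"
  by (simp add: modulation_def bracket_pos)

definition high_const :: real where
  "high_const = 2 powr (2/3) * kernel_const (2/3) (4/3) * (2 * quad_const)"

text \<open>By the triangle inequality the modulations of \<open>i\<close> and \<open>k - i\<close>
  add up to at least \<open>D m\<close>, with \<open>m\<close> the spatial frequency of
  \<open>i\<close>, so the larger one is at least half of \<open>max l (D m)\<close>. At fixed
  \<open>m\<close> the sum over time frequencies leaves \<open>D m powr (- (1/3))\<close>, to which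
  \<open>resonance_sum\<close> applies.\<close>

lemma high_frequency_sum:
  fixes k :: "int \<times> int"
  assumes A: "finite A"
    and le: "\<And>i. i \<in> A \<Longrightarrow> modulation (k - i) \<le> modulation i \<and> modulation i \<le> bracket (fst k) ^ 3"
  shows "(\<Sum>i\<in>A. modulation i powr (- (2/3)) * modulation (k - i) powr (- (2/3))) \<le> high_const"
proof -
  obtain n t where k: "k = (n, t)" by (cases k)
  define D where "D = (\<lambda>m. bracket (t - dispersion m - dispersion (n - m)))"
  define F where "F = {m \<in> fst ` A. D m \<le> 2 * bracket n ^ 3}"
  define T where "T = snd ` A"
  have fin: "finite F" "finite T" using A by (auto simp: F_def T_def)
  have D1: "1 \<le> D m" for m by (simp add: D_def bracket_ge_1)
  have DL: "D (fst i) \<le> 2 * modulation i" if "i \<in> A" for i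
  proof -
    have "D (fst i) \<le> modulation i + modulation (k - i)"
      unfolding D_def modulation_def bracket_def k by simp
    with le[OF that] show ?thesis by simp
  qed
  let ?l = "\<lambda>i. bracket (t - snd i - dispersion (n - fst i))"
  let ?g = "\<lambda>i. 2 powr (2/3) * (?l i powr (- (2/3)) * max (?l i) (D (fst i)) powr (2/3 - 4/3))"
  have l: "modulation (k - i) = ?l i" for i by (simp add: modulation_def k)
  have "(\<Sum>i\<in>A. modulation i powr (- (2/3)) * modulation (k - i) powr (- (2/3))) \<le> (\<Sum>i\<in>A. ?g i)"
  proof (intro sum_mono)
    fix i assume i: "i \<in> A"
    have "max (?l i) (D (fst i)) / 2 \<le> modulation i"
      using le[OF i] DL[OF i] bracket_pos[of "t - snd i - dispersion (n - fst i)"] unfolding l by (auto simp: max_def)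
    moreover have "0 < max (?l i) (D (fst i)) / 2"
      using bracket_pos[of "t - snd i - dispersion (n - fst i)"] by (simp add: max_def)
    ultimately have "modulation i powr (- (2/3)) \<le> (max (?l i) (D (fst i)) / 2) powr (- (2/3))"
      by (intro powr_mono2') auto
    also have "\<dots> = 2 powr (2/3) * max (?l i) (D (fst i)) powr (- (2/3))"
      by (subst powr_divide) (auto simp: powr_minus field_simps bracket_def max_def)
    finally have "modulation i powr (- (2/3)) * modulation (k - i) powr (- (2/3))
        \<le> 2 powr (2/3) * max (?l i) (D (fst i)) powr (- (2/3)) * modulation (k - i) powr (- (2/3))"
      by (intro mult_right_mono) auto
    then show "modulation i powr (- (2/3)) * modulation (k - i) powr (- (2/3)) \<le> ?g i"
      by (simp add: l mult_ac)
  qed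
  \<comment> \<open>Enlarging \<open>A\<close> to a product makes the time sum independent of
    \<open>m\<close>; \<open>F\<close> retains the bound on \<open>D m\<close> that
    \<open>resonance_sum\<close> requires.\<close>
  also have "\<dots> \<le> (\<Sum>i\<in>F \<times> T. ?g i)"
  proof (intro sum_mono2)
    show "A \<subseteq> F \<times> T"
    proof
      fix i assume i: "i \<in> A"
      have "D (fst i) \<le> 2 * bracket n ^ 3" using DL[OF i] le[OF i] by (simp add: k)
      with i show "i \<in> F \<times> T" by (cases i) (force simp: F_def T_def)
    qed
  qed (use fin in auto)
  also have "\<dots> = (\<Sum>m\<in>F. \<Sum>s\<in>T. ?g (m, s))"
    by (simp add: sum.cartesian_product case_prod_beta)
  also have "\<dots> \<le> (\<Sum>m\<in>F. 2 powr (2/3) * (kernel_const (2/3) (4/3) * D m powr (1 - 4/3)))"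
  proof (intro sum_mono)
    fix m assume "m \<in> F"
    have "(\<Sum>s\<in>T. bracket (t - s - dispersion (n - m)) powr (- (2/3)) * max (bracket (t - s - dispersion (n - m))) (D m) powr (2/3 - 4/3))
      \<le> kernel_const (2/3) (4/3) * D m powr (1 - 4/3)"
      using fin D1 by (intro kernel_sum_shift) (auto simp: inj_on_def)
    then show "(\<Sum>s\<in>T. ?g (m, s)) \<le> 2 powr (2/3) * (kernel_const (2/3) (4/3) * D m powr (1 - 4/3))"
      by (simp flip: sum_distrib_left)
  qed
  also have "\<dots> = 2 powr (2/3) * kernel_const (2/3) (4/3) * (\<Sum>m\<in>F. D m powr (- (1/3)))"
    by (simp add: sum_distrib_left mult.assoc)
  also have "\<dots> \<le> 2 powr (2/3) * kernel_const (2/3) (4/3) * (2 * quad_const)"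
    unfolding D_def using fin
    by (intro mult_left_mono resonance_sum) (auto simp: F_def D_def kernel_const_nonneg)
  finally show ?thesis by (simp add: high_const_def)
qed

section \<open>Schur test between modulation and output frequency\<close>

definition low_kernel :: "real \<Rightarrow> real \<Rightarrow> real" where
  "low_kernel l N = l powr (- (1/3)) * max l (N ^ 3) powr (- (1/3))"

text \<open>
  With \<open>m = l powr (1/3)\<close>, this is the classical weight \<open>(m / N) powr (1/2)\<close> for the kernel
  \<open>1 / max m N\<close>, times \<open>m\<close> to account for the density \<open>m\<^sup>2\<close> of \<open>dl\<close> with respect to \<open>dm\<close>.
\<close>

definition schur_weight :: "real \<Rightarrow> real \<Rightarrow> real" where
  "schur_weight l N = l powr (1/2) * N powr (- (1/2))"

text \<open>One side of the Schur test: at fixed \<open>N\<close>, dividing by the weight gives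
  \<open>l\<close> the exponent \<open>- 5/6\<close>, and the kernel sum with
  \<open>R = N ^ 3\<close> returns \<open>N powr (- (1/2))\<close>, which the weight
  cancels.\<close>

lemma schur_sum_modulation:
  assumes "finite T" "1 \<le> N"
  shows "(\<Sum>s\<in>T. low_kernel (bracket (s - t - c)) N / schur_weight (bracket (s - t - c)) N) \<le> kernel_const (5/6) (7/6)"
proof -
  have "low_kernel l N / schur_weight l N = N powr (1/2) * (l powr (- (5/6)) * max l (N ^ 3) powr (5/6 - 7/6))"
    if "0 < l" for l
  proof -
    have "l powr (- (5/6)) = l powr (- (1/3)) / l powr (1/2)"
      using that by (simp add: powr_diff[symmetric])
    then show ?thesis
      using that assms by (simp add: low_kernel_def schur_weight_def powr_minus field_simps)
  qed
  then have "(\<Sum>s\<in>T. low_kernel (bracket (s - t - c)) N / schur_weight (bracket (s - t - c)) N)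
    = N powr (1/2) * (\<Sum>s\<in>T. bracket (s - t - c) powr (- (5/6)) * max (bracket (s - t - c)) (N ^ 3) powr (5/6 - 7/6))"
    by (simp add: sum_distrib_left bracket_pos)
  also have "\<dots> \<le> N powr (1/2) * (kernel_const (5/6) (7/6) * (N ^ 3) powr (1 - 7/6))"
    using assms by (intro mult_left_mono kernel_sum_shift) (auto simp: inj_on_def)
  also have "(N ^ 3) powr (1 - 7/6) = N powr (- (1/2))"
    using assms by (simp add: powr_powr flip: powr_numeral)
  also have "N powr (1/2) * (kernel_const (5/6) (7/6) * N powr (- (1/2))) = kernel_const (5/6) (7/6)"
    using assms by (simp add: powr_minus)
  finally show ?thesis .
qed

text \<open>The other side: at fixed \<open>l\<close>, the cube root of the maximum is
  \<open>max N (l powr (1/3))\<close>, so the kernel sum over \<open>n\<close> has its cut at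
  \<open>R = l powr (1/3)\<close> and returns \<open>l powr (- (1/6))\<close>.\<close>

lemma schur_sum_frequency:
  assumes "finite F" "1 \<le> l"
  shows "(\<Sum>n\<in>F. low_kernel l (bracket n) * schur_weight l (bracket n)) \<le> kernel_const (1/2) (3/2)"
proof -
  have "low_kernel l N * schur_weight l N = l powr (1/6) * (N powr (- (1/2)) * max N (l powr (1/3)) powr (1/2 - 3/2))"
    if "1 \<le> N" for N
  proof -
    have "max l (N ^ 3) powr (1/3) = max N (l powr (1/3))"
    proof (cases "l \<le> N ^ 3")
      case True
      then have "l powr (1/3) \<le> (N ^ 3) powr (1/3)"
        using assms by (intro powr_mono2) auto
      moreover have "(N ^ 3) powr (1/3) = N" using that by (simp add: powr_powr flip: powr_numeral)
      ultimately show ?thesis using True by (simp add: max_def)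
    next
      case False
      then have "(N ^ 3) powr (1/3) \<le> l powr (1/3)"
        using that by (intro powr_mono2) auto
      moreover have "(N ^ 3) powr (1/3) = N" using that by (simp add: powr_powr flip: powr_numeral)
      ultimately show ?thesis using False by (simp add: max_def)
    qed
    then have "max l (N ^ 3) powr (- (1/3)) = inverse (max N (l powr (1/3)))"
      by (simp add: powr_minus)
    also have "\<dots> = max N (l powr (1/3)) powr (1/2 - 3/2)"
      using that by (simp add: powr_minus max_def)
    finally have "max l (N ^ 3) powr (- (1/3)) = max N (l powr (1/3)) powr (1/2 - 3/2)" .
    moreover have "l powr (1/6) = l powr (- (1/3)) * l powr (1/2)"
      using assms by (simp add: powr_add[symmetric])
    ultimately show ?thesis by (simp add: low_kernel_def schur_weight_def mult_ac)
  qed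
  then have "(\<Sum>n\<in>F. low_kernel l (bracket n) * schur_weight l (bracket n))
    = l powr (1/6) * (\<Sum>n\<in>F. bracket n powr (- (1/2)) * max (bracket n) (l powr (1/3)) powr (1/2 - 3/2))"
    by (simp only: sum_distrib_left bracket_ge_1)
  also have "\<dots> \<le> l powr (1/6) * (kernel_const (1/2) (3/2) * (l powr (1/3)) powr (1 - 3/2))"
    using assms by (intro mult_left_mono kernel_sum) (auto simp: ge_one_powr_ge_zero)
  also have "(l powr (1/3)) powr (1 - 3/2) = l powr (- (1/6))"
    by (simp add: powr_powr)
  also have "l powr (1/6) * (kernel_const (1/2) (3/2) * l powr (- (1/6))) = kernel_const (1/2) (3/2)"
    using assms by (simp add: powr_minus)
  finally show ?thesis .
qed


subsection \<open>The bilinear estimate for Fourier coefficients\<close>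

text \<open>The convolution square of \<open>a\<close> when \<open>a\<close> vanishes off the finite
  set \<open>A\<close>.\<close>

definition self_conv :: "'a :: ab_group_add set \<Rightarrow> ('a \<Rightarrow> real) \<Rightarrow> 'a \<Rightarrow> real" where
  "self_conv A a k = (\<Sum>i\<in>A. a i * a (k - i))"

lemma sum_reflect_le:
  fixes h :: "'a :: ab_group_add \<Rightarrow> real"
  assumes "finite A" "\<And>i. 0 \<le> h i" "\<And>i. i \<notin> A \<Longrightarrow> h i = 0" "finite B"
  shows "(\<Sum>i\<in>B. h (k - i)) \<le> (\<Sum>i\<in>A. h i)"
proof -
  have inj: "inj_on (\<lambda>i. k - i) B" by (auto simp: inj_on_def)
  have "(\<Sum>i\<in>B. h (k - i)) = (\<Sum>i\<in>(\<lambda>i. k - i) ` B. h i)"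
    by (simp add: sum.reindex[OF inj])
  also have "\<dots> = (\<Sum>i\<in>(\<lambda>i. k - i) ` B \<inter> A. h i)"
    using assms by (intro sum.mono_neutral_right) auto
  also have "\<dots> \<le> (\<Sum>i\<in>A. h i)"
    using assms by (intro sum_mono2) auto
  finally show ?thesis .
qed

text \<open>Of the two indices \<open>i\<close> and \<open>k - i\<close>, one carries the larger
  modulation, and exchanging them leaves the product unchanged; hence the factor 2.\<close>

lemma self_conv_le_half:
  assumes A: "finite A" and a: "\<And>i. 0 \<le> a i" "\<And>i. i \<notin> A \<Longrightarrow> a i = 0"
  shows "self_conv A a k \<le> 2 * (\<Sum>i | i \<in> A \<and> modulation (k - i) \<le> modulation i. a i * a (k - i))"
proof -
  let ?S = "{i \<in> A. modulation (k - i) \<le> modulation i}"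
  let ?h = "\<lambda>i. if i \<in> ?S then a i * a (k - i) else 0"
  have S: "(\<Sum>i\<in>?S. a i * a (k - i)) = (\<Sum>i\<in>A. ?h i)"
    using A by (intro sum.mono_neutral_cong_left) auto
  have "self_conv A a k \<le> (\<Sum>i\<in>A. ?h i + ?h (k - i))"
    unfolding self_conv_def
  proof (intro sum_mono)
    fix i assume "i \<in> A"
    consider "modulation (k - i) \<le> modulation i" | "modulation i \<le> modulation (k - i)" by linarith
    then show "a i * a (k - i) \<le> ?h i + ?h (k - i)"
    proof cases
      case 1
      then show ?thesis using \<open>i \<in> A\<close> a by simp
    next
      case 2
      then show ?thesis using \<open>i \<in> A\<close> a by (cases "k - i \<in> A") (auto simp: mult.commute)
    qed
  qed
  also have "\<dots> = (\<Sum>i\<in>A. ?h i) + (\<Sum>i\<in>A. ?h (k - i))"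
    by (rule sum.distrib)
  also have "(\<Sum>i\<in>A. ?h (k - i)) \<le> (\<Sum>i\<in>A. ?h i)"
    using A a by (intro sum_reflect_le) auto
  finally show ?thesis unfolding S by linarith
qed

text \<open>Cauchy--Schwarz in \<open>i\<close> separates the weights, whose sum
  \<open>high_frequency_sum\<close> bounds uniformly in \<open>k\<close>. The remaining double sum
  of \<open>(u i)\<^sup>2 * (u (k - i))\<^sup>2\<close> factors after summing over \<open>k\<close>
  first.\<close>

lemma high_part_bound:
  assumes A: "finite A" and u: "\<And>i. 0 \<le> u i" "\<And>i. i \<notin> A \<Longrightarrow> u i = 0" and K: "finite K"
  shows "(\<Sum>k\<in>K. (\<Sum>i | i \<in> A \<and> modulation (k - i) \<le> modulation i \<and> modulation i \<le> bracket (fst k) ^ 3.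
      (u i * u (k - i)) * (modulation i powr (- (1/3)) * modulation (k - i) powr (- (1/3))))\<^sup>2)
    \<le> high_const * (\<Sum>i\<in>A. (u i)\<^sup>2)\<^sup>2"
proof -
  let ?S = "\<lambda>k. {i \<in> A. modulation (k - i) \<le> modulation i \<and> modulation i \<le> bracket (fst k) ^ 3}"
  have "(\<Sum>i\<in>?S k. (u i * u (k - i)) * (modulation i powr (- (1/3)) * modulation (k - i) powr (- (1/3))))\<^sup>2
    \<le> high_const * (\<Sum>i\<in>A. (u i)\<^sup>2 * (u (k - i))\<^sup>2)" for k
  proof -
    have "(\<Sum>i\<in>?S k. (u i * u (k - i)) * (modulation i powr (- (1/3)) * modulation (k - i) powr (- (1/3))))\<^sup>2
      \<le> (\<Sum>i\<in>?S k. (u i * u (k - i))\<^sup>2) * (\<Sum>i\<in>?S k. (modulation i powr (- (1/3)) * modulation (k - i) powr (- (1/3)))\<^sup>2)"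
      by (rule Cauchy_Schwarz_ineq_sum)
    also have "(\<Sum>i\<in>?S k. (modulation i powr (- (1/3)) * modulation (k - i) powr (- (1/3)))\<^sup>2)
      = (\<Sum>i\<in>?S k. modulation i powr (- (2/3)) * modulation (k - i) powr (- (2/3)))"
      by (simp add: power_mult_distrib powr_power less_imp_neq[OF modulation_pos, symmetric])
    also have "(\<Sum>i\<in>?S k. (u i * u (k - i))\<^sup>2) * \<dots> \<le> (\<Sum>i\<in>?S k. (u i * u (k - i))\<^sup>2) * high_const"
      using A by (intro mult_left_mono high_frequency_sum) (auto intro: sum_nonneg)
    also have "\<dots> \<le> (\<Sum>i\<in>A. (u i * u (k - i))\<^sup>2) * high_const"
      \<comment> \<open>The instance with an empty index set says that \<open>high_const\<close> is
        nonnegative.\<close>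
      using A high_frequency_sum[of "{}"] by (intro mult_right_mono sum_mono2) auto
    finally show ?thesis by (simp add: power_mult_distrib mult.commute)
  qed
  then have "(\<Sum>k\<in>K. (\<Sum>i\<in>?S k. (u i * u (k - i)) * (modulation i powr (- (1/3)) * modulation (k - i) powr (- (1/3))))\<^sup>2)
    \<le> (\<Sum>k\<in>K. high_const * (\<Sum>i\<in>A. (u i)\<^sup>2 * (u (k - i))\<^sup>2))"
    by (intro sum_mono)
  also have "\<dots> = high_const * (\<Sum>i\<in>A. (u i)\<^sup>2 * (\<Sum>k\<in>K. (u (k - i))\<^sup>2))"
    by (simp add: sum_distrib_left sum.swap[of _ A K])
  also have "\<dots> \<le> high_const * (\<Sum>i\<in>A. (u i)\<^sup>2 * (\<Sum>i\<in>A. (u i)\<^sup>2))"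
  proof (intro mult_left_mono sum_mono)
    fix i
    \<comment> \<open>The translation by \<open>i\<close> is written as two reflections, so that
      \<open>sum_reflect_le\<close> covers it.\<close>
    have inj: "inj_on (\<lambda>k. i - k) K" by (auto simp: inj_on_def)
    have "(\<Sum>k\<in>K. (u (k - i))\<^sup>2) = (\<Sum>k\<in>(\<lambda>k. i - k) ` K. (u (0 - k))\<^sup>2)"
      by (subst sum.reindex[OF inj]) simp
    also have "\<dots> \<le> (\<Sum>i\<in>A. (u i)\<^sup>2)"
      using A u K by (intro sum_reflect_le) auto
    finally show "(\<Sum>k\<in>K. (u (k - i))\<^sup>2) \<le> (\<Sum>i\<in>A. (u i)\<^sup>2)" .
  qed (use high_frequency_sum[of "{}"] in auto)
  also have "\<dots> = high_const * (\<Sum>i\<in>A. (u i)\<^sup>2)\<^sup>2"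
    by (simp add: power2_eq_square sum_distrib_right)
  finally show ?thesis .
qed

definition low_const :: real where
  "low_const = kernel_const (5/6) (7/6) * kernel_const (1/2) (3/2)"

text \<open>Cauchy--Schwarz with the kernel split into \<open>sqrt (K * w)\<close> and
  \<open>sqrt (K / w)\<close>. After reflection the first factor depends on \<open>k\<close> only
  through \<open>n\<close>; the time sum therefore acts on the second factor alone and is bounded
  uniformly in \<open>n\<close>, after which the sum over \<open>n\<close> acts on the
  first.\<close>

lemma low_part_bound:
  assumes A: "finite A" and u: "\<And>i. 0 \<le> u i" "\<And>i. i \<notin> A \<Longrightarrow> u i = 0" and F: "finite F" and T: "finite T"
  shows "(\<Sum>k\<in>F \<times> T. (\<Sum>i\<in>A. u i * u (k - i) * low_kernel (modulation (k - i)) (bracket (fst k)))\<^sup>2)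
    \<le> low_const * (\<Sum>i\<in>A. (u i)\<^sup>2)\<^sup>2"
proof -
  let ?E = "\<Sum>i\<in>A. (u i)\<^sup>2"
  let ?kw = "\<lambda>i n. low_kernel (modulation i) (bracket n) * schur_weight (modulation i) (bracket n)"
  let ?kd = "\<lambda>i n. low_kernel (modulation i) (bracket n) / schur_weight (modulation i) (bracket n)"
  have kpos: "0 < low_kernel (modulation i) (bracket n)" for i n
    using modulation_pos[of i] bracket_pos[of n] by (simp add: low_kernel_def max_def)
  have wpos: "0 < schur_weight (modulation i) (bracket n)" for i n
    using modulation_pos[of i] bracket_pos[of n] by (simp add: schur_weight_def)
  have pt: "(\<Sum>i\<in>A. u i * u (k - i) * low_kernel (modulation (k - i)) (bracket (fst k)))\<^sup>2
     \<le> (\<Sum>i\<in>A. (u i)\<^sup>2 * ?kw i (fst k)) * (\<Sum>i\<in>A. (u i)\<^sup>2 * ?kd (k - i) (fst k))" for k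
  proof -
    have "u i * u (k - i) * low_kernel (modulation (k - i)) (bracket (fst k))
      = (u (k - i) * sqrt (?kw (k - i) (fst k))) * (u i * sqrt (?kd (k - i) (fst k)))" for i
    proof -
      have "sqrt (?kw (k - i) (fst k)) * sqrt (?kd (k - i) (fst k)) = low_kernel (modulation (k - i)) (bracket (fst k))"
        using kpos[of "k - i" "fst k"] wpos[of "k - i" "fst k"]
        by (simp flip: real_sqrt_mult)
      then show ?thesis by (simp add: mult_ac)
    qed
    then have "(\<Sum>i\<in>A. u i * u (k - i) * low_kernel (modulation (k - i)) (bracket (fst k)))\<^sup>2
      \<le> (\<Sum>i\<in>A. (u (k - i) * sqrt (?kw (k - i) (fst k)))\<^sup>2) * (\<Sum>i\<in>A. (u i * sqrt (?kd (k - i) (fst k)))\<^sup>2)"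
      by (simp only: Cauchy_Schwarz_ineq_sum)
    also have "\<dots> = (\<Sum>i\<in>A. (u (k - i))\<^sup>2 * ?kw (k - i) (fst k)) * (\<Sum>i\<in>A. (u i)\<^sup>2 * ?kd (k - i) (fst k))"
      using kpos wpos by (simp add: power_mult_distrib less_imp_le)
    \<comment> \<open>The reflection removes the time component of \<open>k\<close> from the first
      factor.\<close>
    also have "\<dots> \<le> (\<Sum>i\<in>A. (u i)\<^sup>2 * ?kw i (fst k)) * (\<Sum>i\<in>A. (u i)\<^sup>2 * ?kd (k - i) (fst k))"
    proof (intro mult_right_mono sum_reflect_le sum_nonneg)
      show "0 \<le> (u i)\<^sup>2 * ?kd j n" for i j n
        using kpos[of j n] wpos[of j n] by simp
      show "0 \<le> (u i)\<^sup>2 * ?kw i n" for i n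
        using kpos[of i n] wpos[of i n] by simp
    qed (use A u in auto)
    finally show ?thesis .
  qed
  have inner: "(\<Sum>t\<in>T. \<Sum>i\<in>A. (u i)\<^sup>2 * ?kd ((n, t) - i) n) \<le> kernel_const (5/6) (7/6) * ?E" for n
  proof -
    have "(\<Sum>t\<in>T. \<Sum>i\<in>A. (u i)\<^sup>2 * ?kd ((n, t) - i) n) = (\<Sum>i\<in>A. (u i)\<^sup>2 * (\<Sum>t\<in>T. ?kd ((n, t) - i) n))"
      by (subst sum.swap) (simp add: sum_distrib_left)
    also have "\<dots> \<le> (\<Sum>i\<in>A. (u i)\<^sup>2 * kernel_const (5/6) (7/6))"
    proof (intro sum_mono mult_left_mono)
      fix i
      show "(\<Sum>t\<in>T. ?kd ((n, t) - i) n) \<le> kernel_const (5/6) (7/6)"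
        using schur_sum_modulation[OF T bracket_ge_1] unfolding modulation_def by simp
    qed auto
    finally show ?thesis by (simp add: sum_distrib_right mult.commute)
  qed
  have outer: "(\<Sum>n\<in>F. \<Sum>i\<in>A. (u i)\<^sup>2 * ?kw i n) \<le> kernel_const (1/2) (3/2) * ?E"
  proof -
    have "(\<Sum>n\<in>F. \<Sum>i\<in>A. (u i)\<^sup>2 * ?kw i n) = (\<Sum>i\<in>A. (u i)\<^sup>2 * (\<Sum>n\<in>F. ?kw i n))"
      by (subst sum.swap) (simp add: sum_distrib_left)
    also have "\<dots> \<le> (\<Sum>i\<in>A. (u i)\<^sup>2 * kernel_const (1/2) (3/2))"
      using F by (intro sum_mono mult_left_mono schur_sum_frequency) (auto simp: modulation_ge_1)
    finally show ?thesis by (simp add: sum_distrib_right mult.commute)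
  qed
  have "(\<Sum>k\<in>F \<times> T. (\<Sum>i\<in>A. u i * u (k - i) * low_kernel (modulation (k - i)) (bracket (fst k)))\<^sup>2)
    \<le> (\<Sum>k\<in>F \<times> T. (\<Sum>i\<in>A. (u i)\<^sup>2 * ?kw i (fst k)) * (\<Sum>i\<in>A. (u i)\<^sup>2 * ?kd (k - i) (fst k)))"
    by (intro sum_mono pt)
  also have "\<dots> = (\<Sum>n\<in>F. (\<Sum>i\<in>A. (u i)\<^sup>2 * ?kw i n) * (\<Sum>t\<in>T. \<Sum>i\<in>A. (u i)\<^sup>2 * ?kd ((n, t) - i) n))"
    by (simp add: sum.cartesian_product' sum_distrib_left)
  also have "\<dots> \<le> (\<Sum>n\<in>F. (\<Sum>i\<in>A. (u i)\<^sup>2 * ?kw i n) * (kernel_const (5/6) (7/6) * ?E))"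
    using kpos wpos by (intro sum_mono mult_left_mono inner sum_nonneg) (auto simp: less_imp_le)
  also have "\<dots> = (\<Sum>n\<in>F. \<Sum>i\<in>A. (u i)\<^sup>2 * ?kw i n) * (kernel_const (5/6) (7/6) * ?E)"
    by (rule sum_distrib_right[symmetric])
  also have "\<dots> \<le> (kernel_const (1/2) (3/2) * ?E) * (kernel_const (5/6) (7/6) * ?E)"
    by (intro mult_right_mono outer mult_nonneg_nonneg kernel_const_nonneg sum_nonneg) auto
  finally show ?thesis by (simp add: low_const_def power2_eq_square mult_ac)
qed

text \<open>The half with the larger modulation on \<open>i\<close> is cut at
  \<open>modulation i = bracket (fst k) ^ 3\<close>. The 8 is the square of the 2 from
  \<open>self_conv_le_half\<close> times the 2 from squaring a sum of two parts.\<close>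

lemma self_conv_bound:
  assumes A: "finite A" and a: "\<And>i. 0 \<le> a i" "\<And>i. i \<notin> A \<Longrightarrow> a i = 0" and F: "finite F" and T: "finite T"
  shows "(\<Sum>k\<in>F \<times> T. (self_conv A a k)\<^sup>2)
    \<le> 8 * (high_const + low_const) * (\<Sum>i\<in>A. modulation i powr (2/3) * (a i)\<^sup>2)\<^sup>2"
proof -
  \<comment> \<open>Absorbing the weight turns the Bourgain energy into a plain sum of squares of
    \<open>u\<close>.\<close>
  define u where "u = (\<lambda>i. modulation i powr (1/3) * a i)"
  have u: "0 \<le> u i" "i \<notin> A \<Longrightarrow> u i = 0" for i using a by (auto simp: u_def)
  have au: "a i = u i * modulation i powr (- (1/3))" for i
    using modulation_pos[of i] by (simp add: u_def powr_minus)
  have E: "(\<Sum>i\<in>A. (u i)\<^sup>2) = (\<Sum>i\<in>A. modulation i powr (2/3) * (a i)\<^sup>2)"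
    by (simp add: u_def power_mult_distrib powr_power less_imp_neq[OF modulation_pos, symmetric])
  let ?S1 = "\<lambda>k. {i \<in> A. modulation (k - i) \<le> modulation i \<and> modulation i \<le> bracket (fst k) ^ 3}"
  let ?S2 = "\<lambda>k. {i \<in> A. modulation (k - i) \<le> modulation i \<and> bracket (fst k) ^ 3 < modulation i}"
  let ?f = "\<lambda>k i. (u i * u (k - i)) * (modulation i powr (- (1/3)) * modulation (k - i) powr (- (1/3)))"
  let ?X = "\<lambda>k. \<Sum>i\<in>?S1 k. ?f k i"
  let ?Y = "\<lambda>k. \<Sum>i\<in>A. u i * u (k - i) * low_kernel (modulation (k - i)) (bracket (fst k))"
  have pt: "(self_conv A a k)\<^sup>2 \<le> 8 * ((?X k)\<^sup>2 + (?Y k)\<^sup>2)" for k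
  proof -
    have "{i \<in> A. modulation (k - i) \<le> modulation i} = ?S1 k \<union> ?S2 k" by auto
    then have "(\<Sum>i | i \<in> A \<and> modulation (k - i) \<le> modulation i. ?f k i) = ?X k + (\<Sum>i\<in>?S2 k. ?f k i)"
      using A by (simp only:) (subst sum.union_disjoint, auto)
    \<comment> \<open>Here the larger modulation is at least both \<open>modulation (k - i)\<close>
      and the cube, hence at least their maximum.\<close>
    moreover have "(\<Sum>i\<in>?S2 k. ?f k i) \<le> (\<Sum>i\<in>?S2 k. u i * u (k - i) * low_kernel (modulation (k - i)) (bracket (fst k)))"
    proof (intro sum_mono mult_left_mono)
      fix i assume i: "i \<in> ?S2 k"
      have "modulation i powr (- (1/3)) \<le> max (modulation (k - i)) (bracket (fst k) ^ 3) powr (- (1/3))"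
        using i modulation_pos[of "k - i"] by (intro powr_mono2') (auto simp: less_max_iff_disj)
      then show "modulation i powr (- (1/3)) * modulation (k - i) powr (- (1/3)) \<le> low_kernel (modulation (k - i)) (bracket (fst k))"
        unfolding low_kernel_def by (subst mult.commute) (intro mult_left_mono, auto)
    qed (use u in auto)
    moreover have "\<dots> \<le> ?Y k"
      using A u by (intro sum_mono2) (auto simp: low_kernel_def)
    moreover have "a i * a (k - i) = ?f k i" for i
      by (simp add: au)
    moreover have "self_conv A a k \<le> 2 * (\<Sum>i | i \<in> A \<and> modulation (k - i) \<le> modulation i. a i * a (k - i))"
      using A a by (intro self_conv_le_half) auto
    ultimately have "self_conv A a k \<le> 2 * (?X k + ?Y k)"
      by simp
    moreover have "0 \<le> self_conv A a k"
      unfolding self_conv_def using a by (intro sum_nonneg) auto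
    ultimately have "(self_conv A a k)\<^sup>2 \<le> (2 * (?X k + ?Y k))\<^sup>2"
      by (intro power_mono)
    also have "\<dots> \<le> 8 * ((?X k)\<^sup>2 + (?Y k)\<^sup>2)"
      using sum_squares_bound[of "?X k" "?Y k"] by (simp add: power2_sum power_mult_distrib)
    finally show ?thesis .
  qed
  have "(\<Sum>k\<in>F \<times> T. (self_conv A a k)\<^sup>2) \<le> (\<Sum>k\<in>F \<times> T. 8 * ((?X k)\<^sup>2 + (?Y k)\<^sup>2))"
    by (intro sum_mono pt)
  also have "\<dots> = 8 * ((\<Sum>k\<in>F \<times> T. (?X k)\<^sup>2) + (\<Sum>k\<in>F \<times> T. (?Y k)\<^sup>2))"
    by (simp only: sum.distrib flip: sum_distrib_left)
  also have "\<dots> \<le> 8 * (high_const * (\<Sum>i\<in>A. (u i)\<^sup>2)\<^sup>2 + low_const * (\<Sum>i\<in>A. (u i)\<^sup>2)\<^sup>2)"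
    using A u F T by (intro mult_left_mono add_mono high_part_bound low_part_bound) auto
  finally show ?thesis unfolding E by (simp add: algebra_simps)
qed

subsection \<open>Trigonometric sums on the torus\<close>

definition mode :: "int \<times> int \<Rightarrow> real \<times> real \<Rightarrow> complex" where
  "mode k z = cis (of_int (fst k) * fst z + of_int (snd k) * snd z)"

definition trig_sum :: "(int \<times> int) set \<Rightarrow> (int \<times> int \<Rightarrow> complex) \<Rightarrow> real \<times> real \<Rightarrow> complex" where
  "trig_sum A c z = (\<Sum>k\<in>A. c k * mode k z)"

lemma mode_add: "mode (j + k) z = mode j z * mode k z"
  by (simp add: mode_def cis_mult algebra_simps)

lemma mode_diff: "mode (j - k) z = mode j z * mode (- k) z"
  using mode_add[of j "- k"] by simp

lemma mode_0 [simp]: "mode 0 z = 1"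
  by (simp add: mode_def)

lemma norm_mode [simp]: "norm (mode k z) = 1"
  by (simp add: mode_def)

lemma cnj_mode: "cnj (mode k z) = mode (- k) z"
  by (simp add: mode_def cis_cnj algebra_simps)

lemma mode_uminus: "mode (- (n, \<tau>)) z = exp (- \<i> * complex_of_real (of_int n * fst z + of_int \<tau> * snd z))"
  by (simp add: mode_def cis_conv_exp algebra_simps)

lemma continuous_on_mode [continuous_intros]: "continuous_on S (mode k)"
  unfolding mode_def by (intro continuous_intros)

lemma continuous_on_trig_sum [continuous_intros]: "continuous_on S (trig_sum A c)"
  unfolding trig_sum_def by (intro continuous_intros)

lemma square_eq_cbox: "{0..2 * pi} \<times> {0..2 * pi} = cbox (0, 0) (2 * pi, 2 * pi)"
  by (simp add: cbox_Pair_eq)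

lemma torus_cbox: "torus = lebesgue_on (cbox (0, 0) (2 * pi, 2 * pi))"
  by (simp add: torus_def square_eq_cbox)

lemma space_torus: "space torus = {0..2 * pi} \<times> {0..2 * pi}"
  by (simp add: torus_def)

lemma measurable_torus: "continuous_on UNIV h \<Longrightarrow> h \<in> borel_measurable torus"
  for h :: "real \<times> real \<Rightarrow> 'b :: topological_space"
  unfolding torus_def
  by (intro measurable_restrict_space1 measurable_completion) (simp add: borel_measurable_continuous_onI)

lemma integrable_torus: "continuous_on UNIV h \<Longrightarrow> integrable torus h"
  for h :: "real \<times> real \<Rightarrow> 'b :: euclidean_space"
  unfolding torus_cbox by (intro continuous_imp_integrable) (rule continuous_on_subset, auto)

lemma integral_cis: "integral {0..2 * pi} (\<lambda>x. cis (of_int n * x)) = (if n = 0 then complex_of_real (2 * pi) else 0)"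
proof (cases "n = 0")
  case False
  have "((\<lambda>x. cis (of_int n * x)) has_integral cis (of_int n * (2 * pi)) / (\<i> * of_int n) - cis (of_int n * 0) / (\<i> * of_int n)) {0..2 * pi}"
  proof (rule fundamental_theorem_of_calculus)
    fix x :: real
    have "((\<lambda>x. exp (\<i> * of_int n * complex_of_real x) / (\<i> * of_int n)) has_vector_derivative exp (\<i> * of_int n * complex_of_real x)) (at x within {0..2 * pi})"
      by (rule has_vector_derivative_real_field) (use False in \<open>auto intro!: derivative_eq_intros\<close>)
    then show "((\<lambda>x. cis (of_int n * x) / (\<i> * of_int n)) has_vector_derivative cis (of_int n * x)) (at x within {0..2 * pi})"
      by (simp add: cis_conv_exp mult_ac)
  qed simp
  moreover have "cis (of_int n * (2 * pi)) = 1"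
    using cis_multiple_2pi[of "of_int n"] by (simp add: mult_ac)
  ultimately show ?thesis using False by (simp add: has_integral_iff)
qed (simp add: scaleR_conv_of_real)

lemma integral_mode: "(\<integral>z. mode k z \<partial>torus) = (if k = 0 then complex_of_real ((2 * pi)\<^sup>2) else 0)"
proof -
  have split: "mode k (x, y) = cis (of_int (fst k) * x) * cis (of_int (snd k) * y)" for x y
    by (simp add: mode_def cis_mult)
  have "(\<integral>z. mode k z \<partial>torus) = integral (cbox (0, 0) (2 * pi, 2 * pi)) (mode k)"
    unfolding torus_cbox using integrable_torus[OF continuous_on_mode, of k]
    by (intro lebesgue_integral_eq_integral) (auto simp: torus_cbox)
  also have "\<dots> = integral (cbox 0 (2 * pi)) (\<lambda>x. integral (cbox 0 (2 * pi)) (\<lambda>y. mode k (x, y)))"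
    by (intro integral_prod_continuous continuous_on_mode)
  also have "\<dots> = (if k = 0 then complex_of_real ((2 * pi)\<^sup>2) else 0)"
    unfolding split by (auto simp: integral_cis prod_eq_iff power2_eq_square)
  finally show ?thesis .
qed

lemma parseval:
  assumes "finite A"
  shows "(\<integral>z. (norm (trig_sum A c z))\<^sup>2 \<partial>torus) = (2 * pi)\<^sup>2 * (\<Sum>k\<in>A. (norm (c k))\<^sup>2)"
proof -
  have "complex_of_real ((norm (trig_sum A c z))\<^sup>2) = (\<Sum>j\<in>A. \<Sum>k\<in>A. c j * cnj (c k) * mode (j - k) z)" for z
    unfolding complex_norm_square trig_sum_def cnj_sum sum_product
    by (intro sum.cong) (auto simp: cnj_mode mode_diff mult_ac)
  then have "complex_of_real (\<integral>z. (norm (trig_sum A c z))\<^sup>2 \<partial>torus) = (\<integral>z. (\<Sum>j\<in>A. \<Sum>k\<in>A. c j * cnj (c k) * mode (j - k) z) \<partial>torus)"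
    by (simp flip: integral_complex_of_real)
  also have "\<dots> = (\<Sum>j\<in>A. \<Sum>k\<in>A. c j * cnj (c k) * (\<integral>z. mode (j - k) z \<partial>torus))"
    by (subst Bochner_Integration.integral_sum, simp add: integrable_torus continuous_intros,
        subst Bochner_Integration.integral_sum, simp_all add: integrable_torus continuous_intros)
  also have "\<dots> = (\<Sum>j\<in>A. \<Sum>k\<in>A. if j = k then complex_of_real ((2 * pi)\<^sup>2 * (norm (c k))\<^sup>2) else 0)"
    by (intro sum.cong) (auto simp: integral_mode complex_norm_square[symmetric] simp del: of_real_power)
  also have "\<dots> = complex_of_real ((2 * pi)\<^sup>2 * (\<Sum>k\<in>A. (norm (c k))\<^sup>2))"
    using assms by (simp add: sum_distrib_left)
  finally show ?thesis by (simp only: of_real_eq_iff)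
qed

text \<open>The coefficients of a square are a convolution; \<open>K\<close> must contain all sums
  of two frequencies so that none is lost. The test \<open>k - i \<in> A\<close> stands for
  truncating \<open>c\<close> to \<open>A\<close>.\<close>

lemma trig_sum_square:
  assumes A: "finite A" and K: "finite K" "\<And>i j. i \<in> A \<Longrightarrow> j \<in> A \<Longrightarrow> i + j \<in> K"
  shows "(trig_sum A c z)\<^sup>2 = trig_sum K (\<lambda>k. \<Sum>i\<in>A. if k - i \<in> A then c i * c (k - i) else 0) z"
proof -
  have "trig_sum K (\<lambda>k. \<Sum>i\<in>A. if k - i \<in> A then c i * c (k - i) else 0) z
    = (\<Sum>i\<in>A. \<Sum>k\<in>K. if k - i \<in> A then (c i * mode i z) * (c (k - i) * mode (k - i) z) else 0)"
  proof -
    have "(if k - i \<in> A then c i * c (k - i) else 0) * mode k z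
      = (if k - i \<in> A then (c i * mode i z) * (c (k - i) * mode (k - i) z) else 0)" for i k
    proof -
      have "mode k z = mode i z * mode (k - i) z"
        using mode_add[of i "k - i"] by simp
      then show ?thesis by simp
    qed
    then show ?thesis
      unfolding trig_sum_def sum_distrib_right by (subst sum.swap) (simp only:)
  qed
  also have "\<dots> = (\<Sum>i\<in>A. \<Sum>j\<in>A. (c i * mode i z) * (c j * mode j z))"
  proof (rule sum.cong[OF refl])
    fix i assume i: "i \<in> A"
    have "(\<Sum>k\<in>K. if k - i \<in> A then (c i * mode i z) * (c (k - i) * mode (k - i) z) else 0)
      = (\<Sum>k\<in>(\<lambda>j. i + j) ` A. (c i * mode i z) * (c (k - i) * mode (k - i) z))"
    proof (rule sum.mono_neutral_cong_right)
      show "(\<lambda>j. i + j) ` A \<subseteq> K" using K i by (intro image_subsetI)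
      show "\<forall>k\<in>K - (\<lambda>j. i + j) ` A. (if k - i \<in> A then (c i * mode i z) * (c (k - i) * mode (k - i) z) else 0) = 0"
      proof
        fix k assume k: "k \<in> K - (\<lambda>j. i + j) ` A"
        have "k = i + (k - i)" by simp
        then have "k - i \<notin> A" using k by blast
        then show "(if k - i \<in> A then (c i * mode i z) * (c (k - i) * mode (k - i) z) else 0) = 0" by simp
      qed
    qed (use K in auto)
    also have "\<dots> = (\<Sum>j\<in>A. (c i * mode i z) * (c j * mode j z))"
      by (subst sum.reindex) (auto simp: inj_on_def)
    finally show "(\<Sum>k\<in>K. if k - i \<in> A then (c i * mode i z) * (c (k - i) * mode (k - i) z) else 0)
      = (\<Sum>j\<in>A. (c i * mode i z) * (c j * mode j z))" .
  qed
  also have "\<dots> = (trig_sum A c z)\<^sup>2"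
    by (simp add: trig_sum_def power2_eq_square sum_product)
  finally show ?thesis by simp
qed


subsection \<open>Uniqueness of Fourier coefficients of integrable functions\<close>

text \<open>Carries the square to a product of two circles, on which real polynomials in the
  coordinates are trigonometric polynomials and Stone--Weierstrass applies.\<close>

definition circle_map :: "real \<times> real \<Rightarrow> complex \<times> complex" where
  "circle_map z = (cis (fst z), cis (snd z))"

lemma continuous_on_circle_map: "continuous_on S circle_map"
  unfolding circle_map_def by (intro continuous_intros)

lemma integrable_torus_mult:
  fixes g h :: "real \<times> real \<Rightarrow> complex"
  assumes g: "integrable torus g" and h: "h \<in> borel_measurable torus" and B: "\<And>z. norm (h z) \<le> B"
  shows "integrable torus (\<lambda>z. g z * h z)"
proof (rule Bochner_Integration.integrable_bound)
  show "integrable torus (\<lambda>z. B *\<^sub>R g z)" using g by simp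
  show "(\<lambda>z. g z * h z) \<in> borel_measurable torus" using g h by simp
  have "norm (g z * h z) \<le> norm (B *\<^sub>R g z)" for z
  proof -
    have "norm (g z * h z) \<le> norm (g z) * B"
      unfolding norm_mult using B[of z] by (intro mult_left_mono) auto
    also have "\<dots> \<le> norm (B *\<^sub>R g z)"
      by (simp add: mult.commute mult_right_mono)
    finally show ?thesis .
  qed
  then show "AE z in torus. norm (g z * h z) \<le> norm (B *\<^sub>R g z)" by simp
qed

lemma integrable_torus_mult_mode: "integrable torus g \<Longrightarrow> integrable torus (\<lambda>z. g z * mode k z)"
  by (rule integrable_torus_mult[where B = 1]) (auto intro: measurable_torus continuous_intros)

text \<open>As \<open>k\<close> ranges over all frequencies, this says that every Fourier
  coefficient is zero. The property survives multiplication by a mode, which only shifts the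
  frequency.\<close>

definition vanishing :: "(real \<times> real \<Rightarrow> complex) \<Rightarrow> bool" where
  "vanishing g \<longleftrightarrow> integrable torus g \<and> (\<forall>k. (\<integral>z. g z * mode k z \<partial>torus) = 0)"

lemma vanishing_add: "vanishing f \<Longrightarrow> vanishing g \<Longrightarrow> vanishing (\<lambda>z. f z + g z)"
  unfolding vanishing_def by (simp add: distrib_right integrable_torus_mult_mode)

lemma vanishing_mult_mode:
  assumes "vanishing g"
  shows "vanishing (\<lambda>z. g z * (a * mode k z))"
proof -
  have eq: "g z * (a * mode k z) * mode j z = a * (g z * mode (k + j) z)" for j z
    by (simp add: mode_add mult_ac)
  have "integrable torus (\<lambda>z. a * (g z * mode k z))"
    using assms by (intro integrable_mult_right integrable_torus_mult_mode) (simp add: vanishing_def)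
  moreover have "(\<integral>z. g z * mode j z \<partial>torus) = 0" for j
    using assms unfolding vanishing_def by blast
  ultimately show ?thesis
    unfolding vanishing_def eq by (simp add: mult_ac)
qed

text \<open>A real linear functional of \<open>circle_map z\<close> is a combination of the sines
  and cosines of both coordinates, hence by Euler's formula of four modes. This is the generating
  case for polynomials.\<close>

lemma vanishing_mult_linear:
  fixes h :: "complex \<times> complex \<Rightarrow> real"
  assumes h: "bounded_linear h" and g: "vanishing g"
  shows "vanishing (\<lambda>z. g z * complex_of_real (h (circle_map z)))"
proof -
  interpret bounded_linear h by fact
  define a b c d where "a = h (1, 0)" and "b = h (\<i>, 0)" and "c = h (0, 1)" and "d = h (0, \<i>)"
  have hE: "h (circle_map z) = cos (fst z) * a + sin (fst z) * b + cos (snd z) * c + sin (snd z) * d" for z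
  proof -
    have "circle_map z = cos (fst z) *\<^sub>R (1, 0) + sin (fst z) *\<^sub>R (\<i>, 0) + cos (snd z) *\<^sub>R (0, 1) + sin (snd z) *\<^sub>R (0, \<i>)"
      by (simp add: circle_map_def complex_eq_iff)
    then show ?thesis by (simp only: add scaleR real_scaleR_def a_def b_def c_def d_def)
  qed
  have "complex_of_real (h (circle_map z)) =
      (a - \<i> * b) / 2 * mode (1, 0) z + (a + \<i> * b) / 2 * mode (- 1, 0) z
    + (c - \<i> * d) / 2 * mode (0, 1) z + (c + \<i> * d) / 2 * mode (0, - 1) z" for z
    unfolding hE by (simp add: mode_def complex_eq_iff field_simps)
  then have "(\<lambda>z. g z * complex_of_real (h (circle_map z))) = (\<lambda>z.
      g z * ((a - \<i> * b) / 2 * mode (1, 0) z) + g z * ((a + \<i> * b) / 2 * mode (- 1, 0) z)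
    + g z * ((c - \<i> * d) / 2 * mode (0, 1) z) + g z * ((c + \<i> * d) / 2 * mode (0, - 1) z))"
    by (simp add: distrib_left)
  then show ?thesis
    using g by (simp only:) (intro vanishing_add vanishing_mult_mode)
qed

lemma vanishing_mult_polynomial:
  fixes p :: "complex \<times> complex \<Rightarrow> real"
  assumes "real_polynomial_function p"
  shows "vanishing g \<Longrightarrow> vanishing (\<lambda>z. g z * complex_of_real (p (circle_map z)))"
  using assms
\<comment> \<open>\<open>g\<close> is generalized because the product case applies the second
  hypothesis to \<open>g\<close> already multiplied by the first polynomial.\<close>
proof (induction p arbitrary: g rule: real_polynomial_function.induct)
  case (linear h)
  then show ?case by (rule vanishing_mult_linear)
next
  case (const c)
  then show ?case using vanishing_mult_mode[of g "complex_of_real c" 0] by simp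
next
  case (add p q)
  then show ?case using vanishing_add[OF add.IH] by (simp add: distrib_left)
next
  case (mult p q)
  from mult.IH(2)[OF mult.IH(1)[OF mult.prems]] show ?case by (simp add: mult_ac)
qed

text \<open>Replacing \<open>F\<close> by a polynomial within \<open>e\<close> on the product of
  circles changes the integral by at most \<open>e\<close> times the \<open>L\<^sup>1\<close> norm
  of \<open>g\<close>.\<close>

lemma vanishing_integral_continuous:
  fixes F :: "complex \<times> complex \<Rightarrow> real"
  assumes g: "vanishing g" and F: "continuous_on UNIV F"
  shows "(\<integral>z. g z * complex_of_real (F (circle_map z)) \<partial>torus) = 0"
proof -
  let ?K = "sphere (0::complex) 1 \<times> sphere (0::complex) 1"
  have int: "integrable torus g" using g by (simp add: vanishing_def)
  have K: "compact ?K" by (intro compact_Times) auto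
  have EK: "circle_map z \<in> ?K" for z by (simp add: circle_map_def)
  have bound: "norm (\<integral>z. g z * complex_of_real (F (circle_map z)) \<partial>torus) \<le> e * (\<integral>z. norm (g z) \<partial>torus)" if "e > 0" for e
  proof -
    obtain p where p: "real_polynomial_function p" "\<And>x. x \<in> ?K \<Longrightarrow> \<bar>F x - p x\<bar> < e"
      using Stone_Weierstrass_real_polynomial_function[OF K continuous_on_subset[OF F subset_UNIV] \<open>e > 0\<close>] by blast
    have Fm: "(\<lambda>z. F (circle_map z)) \<in> borel_measurable torus"
      by (intro measurable_torus continuous_on_compose2[OF F continuous_on_circle_map]) auto
    have pc: "continuous_on UNIV p"
      using p(1) by (simp add: continuous_on_polymonial_function real_polynomial_function_eq)
    have pm: "(\<lambda>z. p (circle_map z)) \<in> borel_measurable torus"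
      by (intro measurable_torus continuous_on_compose2[OF pc continuous_on_circle_map]) auto
    have v: "vanishing (\<lambda>z. g z * complex_of_real (p (circle_map z)))"
      by (rule vanishing_mult_polynomial[OF p(1) g])
    have diff: "integrable torus (\<lambda>z. g z * complex_of_real (F (circle_map z) - p (circle_map z)))"
      using p(2)[OF EK] Fm pm by (intro integrable_torus_mult[OF int, where B = e]) (auto simp: less_imp_le simp del: of_real_diff)
    have "(\<integral>z. g z * complex_of_real (F (circle_map z)) \<partial>torus)
      = (\<integral>z. g z * complex_of_real (F (circle_map z) - p (circle_map z)) + g z * complex_of_real (p (circle_map z)) \<partial>torus)"
      by (simp add: algebra_simps)
    also have "\<dots> = (\<integral>z. g z * complex_of_real (F (circle_map z) - p (circle_map z)) \<partial>torus) + (\<integral>z. g z * complex_of_real (p (circle_map z)) \<partial>torus)"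
      using diff v by (intro Bochner_Integration.integral_add) (auto simp: vanishing_def)
    also have "(\<integral>z. g z * complex_of_real (p (circle_map z)) \<partial>torus) = 0"
      using v unfolding vanishing_def by (elim conjE allE[of _ 0]) simp
    finally have "norm (\<integral>z. g z * complex_of_real (F (circle_map z)) \<partial>torus)
      = norm (\<integral>z. g z * complex_of_real (F (circle_map z) - p (circle_map z)) \<partial>torus)" by simp
    also have "\<dots> \<le> (\<integral>z. norm (g z * complex_of_real (F (circle_map z) - p (circle_map z))) \<partial>torus)"
      by (rule integral_norm_bound)
    also have "\<dots> \<le> (\<integral>z. e * norm (g z) \<partial>torus)"
    proof (intro integral_mono)
      fix z
      show "norm (g z * complex_of_real (F (circle_map z) - p (circle_map z))) \<le> e * norm (g z)"
        unfolding norm_mult norm_of_real using p(2)[OF EK, of z]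
        by (subst mult.commute) (intro mult_right_mono, auto)
    qed (use diff int in auto)
    finally show ?thesis by simp
  qed
  have "norm (\<integral>z. g z * complex_of_real (F (circle_map z)) \<partial>torus) \<le> 0"
  proof (rule field_le_epsilon)
    fix d :: real assume d: "d > 0"
    let ?I = "\<integral>z. norm (g z) \<partial>torus"
    have I: "0 \<le> ?I" by simp
    \<comment> \<open>Adding 1 guards against a zero \<open>L\<^sup>1\<close> norm.\<close>
    have "d / (?I + 1) > 0" using d I by (intro divide_pos_pos add_nonneg_pos) auto
    from bound[OF this] have "norm (\<integral>z. g z * complex_of_real (F (circle_map z)) \<partial>torus) \<le> d / (?I + 1) * ?I" .
    also have "\<dots> \<le> d" using d by (simp add: pos_divide_le_eq add_nonneg_pos distrib_left)
    finally show "norm (\<integral>z. g z * complex_of_real (F (circle_map z)) \<partial>torus) \<le> 0 + d" by simp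
  qed
  then show ?thesis by simp
qed

text \<open>The coordinates differ by multiples of \<open>2 * pi\<close>, and with one point
  interior the difference is smaller than \<open>2 * pi\<close>. On the boundary itself opposite
  edges are identified.\<close>

lemma circle_map_eq_interior:
  assumes "y \<in> {0<..<2 * pi} \<times> {0<..<2 * pi}" "z \<in> {0..2 * pi} \<times> {0..2 * pi}" "circle_map z = circle_map y"
  shows "z = y"
proof -
  have "s = t" if "0 < t" "t < 2 * pi" "0 \<le> s" "s \<le> 2 * pi" "cis s = cis t" for s t
  proof -
    have "sin s = sin t \<and> cos s = cos t" using that(5) by (simp add: complex_eq_iff)
    then obtain n :: int where n: "s = t + 2 * pi * n" unfolding sin_cos_eq_iff by blast
    have "\<bar>2 * pi * real_of_int n\<bar> < 2 * pi * 1" using n that by linarith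
    then have "\<bar>real_of_int n\<bar> < 1" by (simp add: abs_mult)
    then show ?thesis using n by simp
  qed
  then show ?thesis using assms by (auto simp: circle_map_def)
qed

text \<open>The indicator of \<open>Q\<close> is the pointwise limit of tents \<open>?F m\<close>,
  dominated by 1. The distance is measured on the circles, where the tents are continuous test
  functions; injectivity on the interior separates points outside \<open>Q\<close> from its
  image.\<close>

lemma vanishing_integral_compact:
  assumes g: "vanishing g" and Q: "compact Q" "Q \<subseteq> {0<..<2 * pi} \<times> {0<..<2 * pi}"
  shows "(\<integral>z. g z * complex_of_real (indicator Q z) \<partial>torus) = 0"
\<comment> \<open>The empty case is separate: \<open>infdist\<close> to the empty set is 0, so the
  tents would be constantly 1.\<close>
proof (cases "Q = {}")
  case False
  let ?D = "\<lambda>w. infdist w (circle_map ` Q)"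
  let ?F = "\<lambda>m w. max 0 (1 - real m * ?D w)"
  have int: "integrable torus g" using g by (simp add: vanishing_def)
  have cl: "closed (circle_map ` Q)"
    using Q by (intro compact_imp_closed compact_continuous_image continuous_on_circle_map)
  have Fc: "continuous_on UNIV (?F m)" for m by (intro continuous_intros)
  have Fm: "(\<lambda>z. ?F m (circle_map z)) \<in> borel_measurable torus" for m
    by (intro measurable_torus continuous_on_compose2[OF Fc continuous_on_circle_map]) auto
  have lim: "(\<lambda>m. g z * complex_of_real (?F m (circle_map z))) \<longlonglongrightarrow> g z * complex_of_real (indicator Q z)" if "z \<in> space torus" for z
  proof (cases "z \<in> Q")
    case True
    then show ?thesis by simp
  next
    case z: False
    have "circle_map z \<notin> circle_map ` Q"
      using circle_map_eq_interior z Q that unfolding space_torus by blast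
    then have pos: "?D (circle_map z) > 0"
      using cl False by (intro infdist_pos_not_in_closed) auto
    obtain m0 :: nat where m0: "1 / ?D (circle_map z) \<le> real m0" using real_arch_simple by blast
    have "\<forall>\<^sub>F m in sequentially. g z * complex_of_real (?F m (circle_map z)) = g z * complex_of_real (indicator Q z)"
      using eventually_ge_at_top[of m0]
    proof eventually_elim
      case (elim m)
      then have "1 / ?D (circle_map z) \<le> real m" using m0 by simp
      then have "1 \<le> real m * ?D (circle_map z)" using pos by (simp add: field_simps)
      then show ?case using z by simp
    qed
    then show ?thesis by (rule tendsto_eventually)
  qed
  have "(\<lambda>m. \<integral>z. g z * complex_of_real (?F m (circle_map z)) \<partial>torus) \<longlonglongrightarrow> (\<integral>z. g z * complex_of_real (indicator Q z) \<partial>torus)"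
  proof (rule integral_dominated_convergence[where w = "\<lambda>z. norm (g z)"])
    show "AE z in torus. (\<lambda>m. g z * complex_of_real (?F m (circle_map z))) \<longlonglongrightarrow> g z * complex_of_real (indicator Q z)"
      using lim by (intro AE_I2)
    show "AE z in torus. norm (g z * complex_of_real (?F m (circle_map z))) \<le> norm (g z)" for m
      by (intro AE_I2) (auto simp: norm_mult infdist_nonneg intro!: mult_left_le)
    have "Q \<in> sets borel" using Q by (intro borel_closed compact_imp_closed)
    then have "(indicator Q :: real \<times> real \<Rightarrow> real) \<in> borel_measurable borel" by simp
    then have "(indicator Q :: real \<times> real \<Rightarrow> real) \<in> borel_measurable torus"
      unfolding torus_def by (intro measurable_restrict_space1 measurable_completion) simp
    then show "(\<lambda>z. g z * complex_of_real (indicator Q z)) \<in> borel_measurable torus"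
      using int by simp
    show "(\<lambda>z. g z * complex_of_real (?F m (circle_map z))) \<in> borel_measurable torus" for m
      using int Fm[of m] by simp
  qed (use int in auto)
  moreover have "(\<integral>z. g z * complex_of_real (?F m (circle_map z)) \<partial>torus) = 0" for m
    by (rule vanishing_integral_continuous[OF g Fc])
  ultimately show ?thesis using LIMSEQ_unique tendsto_const by (simp only:) blast
qed simp

section \<open>From integrals over compact sets to vanishing almost everywhere\<close>

lemma AE_torus_interior: "AE z in torus. z \<in> {0<..<2 * pi} \<times> {0<..<2 * pi}"
proof -
  have "negligible (cbox (0, 0) (2 * pi, 2 * pi) - box (0, 0) (2 * pi, 2 * pi) :: (real \<times> real) set)"
    by (rule negligible_frontier_interval)
  then have "AE z in lebesgue. z \<notin> cbox (0, 0) (2 * pi, 2 * pi) - box (0, 0) (2 * pi, 2 * pi :: real)"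
    by (intro AE_not_in) (simp add: negligible_iff_null_sets)
  then have "AE z in lebesgue. z \<in> cbox (0, 0) (2 * pi, 2 * pi) \<longrightarrow> z \<in> {0<..<2 * pi} \<times> {0<..<2 * pi}"
    by eventually_elim (auto simp: box_def Basis_prod_def)
  then show ?thesis
    unfolding torus_cbox by (subst AE_restrict_space_iff) auto
qed

text \<open>Inner regularity fills the set where \<open>h > 0\<close> by closed subsets up to small
  measure. Each is compact, and a zero integral of a positive function over it makes it
  null.\<close>

lemma AE_nonpos_if_integral_compact_zero:
  fixes h :: "real \<times> real \<Rightarrow> real"
  assumes h: "integrable torus h"
    and zero: "\<And>Q. compact Q \<Longrightarrow> Q \<subseteq> {0<..<2 * pi} \<times> {0<..<2 * pi} \<Longrightarrow> (\<integral>z. h z * indicator Q z \<partial>torus) = 0"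
  shows "AE z in torus. h z \<le> 0"
proof -
  let ?S = "{0..2 * pi} \<times> {0..2 * pi}"
  \<comment> \<open>The hypothesis tests only subsets of the open square;
    \<open>AE_torus_interior\<close> accounts for the boundary at the end.\<close>
  define P where "P = {z \<in> space torus. 0 < h z} \<inter> {0<..<2 * pi} \<times> {0<..<2 * pi}"
  have S: "?S \<in> sets lebesgue" by (simp add: square_eq_cbox)
  have "{z \<in> space torus. 0 < h z} \<in> sets torus"
    using borel_measurable_integrable[OF h] by simp
  then have P: "P \<in> sets lebesgue"
    unfolding P_def using S by (intro sets.Int) (auto simp: torus_def sets_restrict_space_iff open_Times)
  have null: "emeasure lebesgue T = 0" if T: "closed T" "T \<subseteq> P" for T
  proof -
    have "bounded T"
      by (rule bounded_subset[of "cbox (0, 0) (2 * pi, 2 * pi)"]) (use T in \<open>auto simp: P_def space_torus\<close>)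
    then have cT: "compact T" using T by (simp add: compact_eq_bounded_closed)
    have Tm: "T \<in> sets borel" using T by simp
    then have TS: "T \<in> sets torus"
      unfolding torus_def using T S by (subst sets_restrict_space_iff) (auto simp: P_def space_torus)
    have hT: "integrable torus (\<lambda>z. h z * indicator T z)"
      using h TS by (intro integrable_real_mult_indicator)
    have "AE z in torus. h z * indicator T z = 0"
    proof (subst integral_nonneg_eq_0_iff_AE[symmetric])
      show "AE z in torus. 0 \<le> h z * indicator T z"
        using T by (intro AE_I2) (auto simp: P_def indicator_def)
      show "(\<integral>z. h z * indicator T z \<partial>torus) = 0"
        by (rule zero) (use T cT in \<open>auto simp: P_def\<close>)
    qed fact
    then have "AE z in torus. z \<notin> T"
      by eventually_elim (use T in \<open>auto simp: P_def indicator_def\<close>)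
    then have "AE z in lebesgue. z \<in> ?S \<longrightarrow> z \<notin> T"
      unfolding torus_def using S by (subst (asm) AE_restrict_space_iff) auto
    then have "AE z in lebesgue. z \<notin> T"
      by eventually_elim (use T in \<open>auto simp: P_def space_torus\<close>)
    then have "T \<in> null_sets lebesgue"
      using Tm by (subst AE_iff_null_sets) auto
    then show ?thesis by auto
  qed
  have "emeasure lebesgue P \<le> 0"
  proof (rule ennreal_le_epsilon)
    fix e :: real assume "e > 0"
    obtain T where T: "closed T" "T \<subseteq> P" "P - T \<in> lmeasurable" "emeasure lebesgue (P - T) < ennreal e"
      by (rule sets_lebesgue_inner_closed[OF P \<open>e > 0\<close>])
    have "emeasure lebesgue P = emeasure lebesgue ((P - T) \<union> T)"
      using T by (simp add: Un_absorb2)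
    also have "\<dots> \<le> emeasure lebesgue (P - T) + emeasure lebesgue T"
      using T by (intro emeasure_subadditive) (auto simp: fmeasurableD)
    also have "\<dots> \<le> 0 + ennreal e" using null[OF T(1,2)] T(4) by simp
    finally show "emeasure lebesgue P \<le> 0 + ennreal e" .
  qed
  then have "P \<in> null_sets lebesgue" using P by auto
  then have "AE z in lebesgue. z \<notin> P" by (rule AE_not_in)
  then have "AE z in torus. z \<notin> P"
    unfolding torus_def using S by (subst AE_restrict_space_iff) auto
  with AE_torus_interior AE_space show ?thesis
    by eventually_elim (auto simp: P_def)
qed

text \<open>The one-sided criterion is applied to the real and imaginary parts and their negatives,
  all of the form \<open>L (g z)\<close> with \<open>L\<close> bounded linear.\<close>

lemma vanishing_AE_zero:
  assumes g: "vanishing g"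
  shows "AE z in torus. g z = 0"
proof -
  have int: "integrable torus g" using g by (simp add: vanishing_def)
  have le: "AE z in torus. h z \<le> 0"
    if L: "bounded_linear L" and h: "h = (\<lambda>z. L (g z))" for h and L :: "complex \<Rightarrow> real"
  proof (rule AE_nonpos_if_integral_compact_zero)
    show "integrable torus h" unfolding h by (rule integrable_bounded_linear[OF L int])
    fix Q :: "(real \<times> real) set" assume Q: "compact Q" "Q \<subseteq> {0<..<2 * pi} \<times> {0<..<2 * pi}"
    have "Q \<in> sets borel" using Q by (intro borel_closed compact_imp_closed)
    then have "(\<lambda>z. complex_of_real (indicator Q z)) \<in> borel_measurable torus"
      unfolding torus_def
      by (intro measurable_restrict_space1 measurable_completion borel_measurable_of_real) simp
    then have gQ: "integrable torus (\<lambda>z. g z * complex_of_real (indicator Q z))"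
      by (rule integrable_torus_mult[OF int, where B = 1]) (simp add: indicator_def)
    have "(\<integral>z. h z * indicator Q z \<partial>torus) = (\<integral>z. L (g z * complex_of_real (indicator Q z)) \<partial>torus)"
      by (intro Bochner_Integration.integral_cong) (auto simp: h indicator_def linear_0[OF bounded_linear.linear[OF L]])
    also have "\<dots> = L (\<integral>z. g z * complex_of_real (indicator Q z) \<partial>torus)"
      by (rule integral_bounded_linear[OF L gQ])
    also have "\<dots> = 0"
      using vanishing_integral_compact[OF g Q] linear_0[OF bounded_linear.linear[OF L]] by simp
    finally show "(\<integral>z. h z * indicator Q z \<partial>torus) = 0" .
  qed
  have "AE z in torus. Re (g z) \<le> 0" by (rule le[OF bounded_linear_Re refl])
  moreover have "AE z in torus. - Re (g z) \<le> 0"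
    by (rule le[OF bounded_linear_minus[OF bounded_linear_Re] refl])
  moreover have "AE z in torus. Im (g z) \<le> 0" by (rule le[OF bounded_linear_Im refl])
  moreover have "AE z in torus. - Im (g z) \<le> 0"
    by (rule le[OF bounded_linear_minus[OF bounded_linear_Im] refl])
  ultimately show ?thesis
    by eventually_elim (auto simp: complex_eq_iff)
qed

subsection \<open>Almost everywhere convergence of partial Fourier sums\<close>

text \<open>Fatou's lemma for a uniform bound; it serves both the completeness of
  \<open>L\<^sup>1\<close> and the final \<open>L\<^sup>4\<close> bound.\<close>

lemma nn_integral_AE_limit_le:
  fixes u :: "nat \<Rightarrow> 'a \<Rightarrow> ennreal"
  assumes u: "\<And>n. u n \<in> borel_measurable M" and lim: "AE x in M. (\<lambda>n. u n x) \<longlonglongrightarrow> v x"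
    and B: "\<forall>\<^sub>F n in sequentially. (\<integral>\<^sup>+x. u n x \<partial>M) \<le> B"
  shows "(\<integral>\<^sup>+x. v x \<partial>M) \<le> B"
proof -
  have "(\<integral>\<^sup>+x. v x \<partial>M) = (\<integral>\<^sup>+x. liminf (\<lambda>n. u n x) \<partial>M)"
    by (intro nn_integral_cong_AE, use lim in eventually_elim) (simp add: lim_imp_Liminf)
  also have "\<dots> \<le> liminf (\<lambda>n. \<integral>\<^sup>+x. u n x \<partial>M)"
    using u by (rule nn_integral_liminf)
  also have "\<dots> \<le> B"
    using B by (intro Liminf_le) auto
  finally show ?thesis .
qed

text \<open>Completeness of \<open>L\<^sup>1\<close> with one subsequence giving both kinds of
  convergence: an almost everywhere limit is taken first, and Fatou in one index of the Cauchy
  condition gives the norm convergence.\<close>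

lemma L1_Cauchy_limit:
  fixes s :: "nat \<Rightarrow> 'a \<Rightarrow> 'b :: {banach, second_countable_topology}"
  assumes int: "\<And>n. integrable M (s n)"
    and Cauchy: "\<And>e. e > 0 \<Longrightarrow> \<exists>N. \<forall>i\<ge>N. \<forall>j\<ge>N. (\<integral>x. norm (s i x - s j x) \<partial>M) < e"
  obtains r h where "strict_mono r" "integrable M h" "AE x in M. (\<lambda>n. s (r n) x) \<longlonglongrightarrow> h x"
    "(\<lambda>n. \<integral>x. norm (h x - s (r n) x) \<partial>M) \<longlonglongrightarrow> 0"
proof -
  obtain r where r: "strict_mono r" "AE x in M. Cauchy (\<lambda>i. s (r i) x)"
    using cauchy_L1_AE_cauchy_subseq[OF int Cauchy] by blast
  define h where "h x = lim (\<lambda>n. s (r n) x)" for x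
  have [measurable]: "s n \<in> borel_measurable M" for n using int by simp
  have [measurable]: "h \<in> borel_measurable M"
    unfolding h_def by (intro borel_measurable_lim_metric) simp
  have lim: "AE x in M. (\<lambda>n. s (r n) x) \<longlonglongrightarrow> h x"
    using r(2) by eventually_elim (simp add: h_def Cauchy_convergent_iff convergent_LIMSEQ_iff)
  have close: "\<exists>N. \<forall>n\<ge>N. (\<integral>\<^sup>+x. norm (h x - s (r n) x) \<partial>M) \<le> ennreal e" if e: "e > 0" for e
  proof -
    obtain N where N: "\<And>i j. i \<ge> N \<Longrightarrow> j \<ge> N \<Longrightarrow> (\<integral>x. norm (s i x - s j x) \<partial>M) < e"
      using Cauchy[OF e] by blast
    have rN: "r n \<ge> N" if "n \<ge> N" for n
      using that seq_suble[OF r(1), of n] by linarith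
    have "(\<integral>\<^sup>+x. norm (h x - s (r n) x) \<partial>M) \<le> ennreal e" if n: "n \<ge> N" for n
    proof (rule nn_integral_AE_limit_le)
      show "AE x in M. (\<lambda>m. ennreal (norm (s (r m) x - s (r n) x))) \<longlonglongrightarrow> ennreal (norm (h x - s (r n) x))"
        using lim by eventually_elim (intro tendsto_intros tendsto_ennrealI)
      show "\<forall>\<^sub>F m in sequentially. (\<integral>\<^sup>+x. norm (s (r m) x - s (r n) x) \<partial>M) \<le> ennreal e"
        using eventually_ge_at_top[of N]
      proof eventually_elim
        case (elim m)
        have "(\<integral>\<^sup>+x. norm (s (r m) x - s (r n) x) \<partial>M) = ennreal (\<integral>x. norm (s (r m) x - s (r n) x) \<partial>M)"
          using int by (intro nn_integral_eq_integral) auto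
        also have "\<dots> \<le> ennreal e"
          using N[OF rN[OF elim] rN[OF n]] by (intro ennreal_leI) simp
        finally show ?case .
      qed
    qed measurable
    then show ?thesis by blast
  qed
  obtain N1 where N1: "\<And>n. n \<ge> N1 \<Longrightarrow> (\<integral>\<^sup>+x. norm (h x - s (r n) x) \<partial>M) \<le> ennreal 1"
    using close[of 1] by auto
  \<comment> \<open>\<open>h\<close> is integrable because it lies at finite
    \<open>L\<^sup>1\<close> distance from the integrable \<open>s (r N1)\<close>.\<close>
  have "integrable M (\<lambda>x. h x - s (r N1) x)"
    using N1[of N1] by (intro integrableI_bounded) (auto simp: ennreal_1[symmetric] intro: le_less_trans simp del: ennreal_1)
  then have "integrable M (\<lambda>x. (h x - s (r N1) x) + s (r N1) x)"
    using int by (intro Bochner_Integration.integrable_add)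
  then have h: "integrable M h" by simp
  have "(\<lambda>n. \<integral>x. norm (h x - s (r n) x) \<partial>M) \<longlonglongrightarrow> 0"
  proof (rule LIMSEQ_I)
    fix e :: real assume "e > 0"
    then obtain N where N: "\<And>n. n \<ge> N \<Longrightarrow> (\<integral>\<^sup>+x. norm (h x - s (r n) x) \<partial>M) \<le> ennreal (e / 2)"
      using close[of "e / 2"] by auto
    have "norm ((\<integral>x. norm (h x - s (r n) x) \<partial>M) - 0) < e" if "n \<ge> N" for n
    proof -
      have "ennreal (\<integral>x. norm (h x - s (r n) x) \<partial>M) = (\<integral>\<^sup>+x. norm (h x - s (r n) x) \<partial>M)"
        using h int by (intro nn_integral_eq_integral[symmetric]) auto
      also have "\<dots> \<le> ennreal (e / 2)" using N[OF that] .
      finally have "(\<integral>x. norm (h x - s (r n) x) \<partial>M) \<le> e / 2"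
        using \<open>e > 0\<close> by (subst (asm) ennreal_le_iff) auto
      then show ?thesis using \<open>e > 0\<close> by simp
    qed
    then show "\<exists>N. \<forall>n\<ge>N. norm ((\<integral>x. norm (h x - s (r n) x) \<partial>M) - 0) < e" by blast
  qed
  with r h lim show thesis by (intro that)
qed

lemma measure_torus: "measure torus (space torus) = (2 * pi)\<^sup>2"
proof -
  have "complex_of_real (measure torus (space torus)) = complex_of_real ((2 * pi)\<^sup>2)"
    using integral_mode[of 0] by (simp add: scaleR_conv_of_real)
  then show ?thesis by (simp only: of_real_eq_iff)
qed

text \<open>The pointwise inequality \<open>y \<le> d / 2 + y\<^sup>2 / (2 * d)\<close> reduces the
  \<open>L\<^sup>1\<close> norm to Parseval, and each of the two terms contributes half of the
  bound.\<close>

lemma trig_sum_L1_le: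
  assumes A: "finite A" and d: "0 < d" and c: "(\<Sum>k\<in>A. (norm (c k))\<^sup>2) \<le> d\<^sup>2"
  shows "(\<integral>z. norm (trig_sum A c z) \<partial>torus) \<le> (2 * pi)\<^sup>2 * d"
proof -
  have i2: "integrable torus (\<lambda>z. (norm (trig_sum A c z))\<^sup>2)"
    by (intro integrable_torus continuous_intros)
  have i0: "integrable torus (\<lambda>z. d / 2)"
    by (intro integrable_torus continuous_intros)
  have "(\<integral>z. norm (trig_sum A c z) \<partial>torus) \<le> (\<integral>z. d / 2 + (norm (trig_sum A c z))\<^sup>2 / (2 * d) \<partial>torus)"
  proof (intro integral_mono)
    show "integrable torus (\<lambda>z. norm (trig_sum A c z))"
      by (intro integrable_torus continuous_intros)
    show "integrable torus (\<lambda>z. d / 2 + (norm (trig_sum A c z))\<^sup>2 / (2 * d))"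
      using i2 i0 by simp
    fix z
    have "2 * d * norm (trig_sum A c z) \<le> d\<^sup>2 + (norm (trig_sum A c z))\<^sup>2"
      by (rule sum_squares_bound)
    then show "norm (trig_sum A c z) \<le> d / 2 + (norm (trig_sum A c z))\<^sup>2 / (2 * d)"
      using d by (simp add: field_simps power2_eq_square)
  qed
  also have "\<dots> = (2 * pi)\<^sup>2 * (d / 2) + (2 * pi)\<^sup>2 * (\<Sum>k\<in>A. (norm (c k))\<^sup>2) / (2 * d)"
    using i2 i0 by (simp add: measure_torus parseval[OF A])
  also have "\<dots> \<le> (2 * pi)\<^sup>2 * (d / 2) + (2 * pi)\<^sup>2 * d\<^sup>2 / (2 * d)"
    using c d by (intro add_left_mono divide_right_mono mult_left_mono) auto
  also have "\<dots> = (2 * pi)\<^sup>2 * d"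
    using d by (simp add: power2_eq_square)
  finally show ?thesis .
qed

lemma integral_trig_sum_mode:
  assumes "finite A"
  shows "(\<integral>z. trig_sum A c z * mode (- k) z \<partial>torus) = (if k \<in> A then complex_of_real ((2 * pi)\<^sup>2) * c k else 0)"
proof -
  have "trig_sum A c z * mode (- k) z = (\<Sum>j\<in>A. c j * mode (j - k) z)" for z
    by (simp add: trig_sum_def sum_distrib_right mode_diff mult.assoc)
  then have "(\<integral>z. trig_sum A c z * mode (- k) z \<partial>torus) = (\<Sum>j\<in>A. c j * (\<integral>z. mode (j - k) z \<partial>torus))"
    by (simp add: integrable_torus continuous_intros)
  also have "\<dots> = (\<Sum>j\<in>A. if k = j then complex_of_real ((2 * pi)\<^sup>2) * c k else 0)"
    unfolding integral_mode by (intro sum.cong) auto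
  finally show ?thesis using assms by simp
qed

lemma integral_mult_mode:
  "(\<integral>z. f z * mode (- k) z \<partial>torus) = complex_of_real ((2 * pi)\<^sup>2) * fourier_coeff f (fst k) (snd k)"
proof -
  have "mode (- k) z = exp (- \<i> * complex_of_real (of_int (fst k) * fst z + of_int (snd k) * snd z))" for z
    using mode_uminus[of "fst k" "snd k"] by simp
  then show ?thesis by (simp add: fourier_coeff_def)
qed

lemma trig_sums_AE_converge:
  fixes f :: "real \<times> real \<Rightarrow> complex"
  defines "c \<equiv> \<lambda>k. fourier_coeff f (fst k) (snd k)"
  assumes f: "integrable torus f" and c: "(\<lambda>k. (norm (c k))\<^sup>2) summable_on UNIV"
  obtains A where "\<And>n. finite (A n)" "AE z in torus. (\<lambda>n. trig_sum (A n) c z) \<longlonglongrightarrow> f z"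
proof -
  let ?q = "\<lambda>k. (norm (c k))\<^sup>2"
  define I where "I = infsum ?q UNIV"
  have "\<exists>F. finite F \<and> dist (sum ?q F) I \<le> 1 / real (Suc n)" for n
    using infsum_finite_approximation[OF c, of "1 / real (Suc n)"] unfolding I_def by auto
  then obtain X where X: "\<And>n. finite (X n)" "\<And>n. dist (sum ?q (X n)) I \<le> 1 / real (Suc n)"
    by metis
  \<comment> \<open>The sets \<open>X i\<close> control the tails of the square sum, the boxes
    exhaust all frequencies, and the union makes the sequence increasing.\<close>
  define A where "A = (\<lambda>n. \<Union>i\<le>n. X i \<union> {- int i..int i} \<times> {- int i..int i})"
  have A: "finite (A n)" for n using X by (auto simp: A_def)
  have A_mono: "A m \<subseteq> A n" if "m \<le> n" for m n using that by (fastforce simp: A_def)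
  have A_cover: "\<exists>n. k \<in> A n" for k
  proof
    let ?m = "nat (max \<bar>fst k\<bar> \<bar>snd k\<bar>)"
    have "k \<in> {- int ?m..int ?m} \<times> {- int ?m..int ?m}" by (cases k) auto
    then show "k \<in> A ?m" unfolding A_def by blast
  qed
  have tail: "sum ?q B \<le> 1 / real (Suc n)" if "finite B" "B \<inter> A n = {}" for B n
  proof -
    have "sum ?q (X n) \<le> sum ?q (A n)"
      using A[of n] by (intro sum_mono2) (auto simp: A_def)
    moreover have "sum ?q (B \<union> A n) \<le> I"
      unfolding I_def using c A that by (intro finite_sum_le_infsum) auto
    moreover have "sum ?q (B \<union> A n) = sum ?q B + sum ?q (A n)"
      using that A by (intro sum.union_disjoint) auto
    ultimately show ?thesis using X(2)[of n] by (simp add: dist_real_def)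
  qed
  \<comment> \<open>Working with the remainders, it suffices to show that their limit
    \<open>h\<close> is zero.\<close>
  define s where "s = (\<lambda>n z. f z - trig_sum (A n) c z)"
  have s: "integrable torus (s n)" for n
    unfolding s_def
    by (rule Bochner_Integration.integrable_diff[OF f]) (intro integrable_torus continuous_intros)
  have le: "(\<integral>z. norm (s i z - s j z) \<partial>torus) \<le> (2 * pi)\<^sup>2 * d"
    if "i \<le> j" "0 < d" "1 / real (Suc i) \<le> d\<^sup>2" for i j d
  proof -
    have "s i z - s j z = trig_sum (A j - A i) c z" for z
      using A A_mono[OF that(1)] by (simp add: s_def trig_sum_def sum_diff)
    moreover have "sum ?q (A j - A i) \<le> 1 / real (Suc i)"
      using A by (intro tail) auto
    then have "sum ?q (A j - A i) \<le> d\<^sup>2" using that(3) by (rule order_trans)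
    ultimately show ?thesis using trig_sum_L1_le[of "A j - A i" d c] A that by simp
  qed
  have cauchy: "\<exists>N. \<forall>i\<ge>N. \<forall>j\<ge>N. (\<integral>z. norm (s i z - s j z) \<partial>torus) < e" if e: "e > 0" for e
  proof -
    define d where "d = e / (2 * (2 * pi)\<^sup>2)"
    have d: "d > 0" using e by (simp add: d_def)
    have de: "(2 * pi)\<^sup>2 * d < e" using e by (simp add: d_def)
    obtain N where N: "inverse (real (Suc N)) < d\<^sup>2"
      using reals_Archimedean[of "d\<^sup>2"] d by auto
    have small: "1 / real (Suc i) \<le> d\<^sup>2" if "i \<ge> N" for i
    proof -
      have "inverse (real (Suc i)) \<le> inverse (real (Suc N))"
        using that by (intro le_imp_inverse_le) auto
      then show ?thesis using N by (simp add: inverse_eq_divide)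
    qed
    have "(\<integral>z. norm (s i z - s j z) \<partial>torus) < e" if ij: "i \<ge> N" "j \<ge> N" for i j
    proof (cases "i \<le> j")
      case True
      then show ?thesis using le[OF True d small[OF ij(1)]] de by linarith
    next
      case False
      then have "j \<le> i" by simp
      from le[OF this d small[OF ij(2)]] show ?thesis
        using de by (simp add: norm_minus_commute)
    qed
    then show ?thesis by blast
  qed
  obtain r h where r: "strict_mono r" and h: "integrable torus h"
    and lim: "AE z in torus. (\<lambda>n. s (r n) z) \<longlonglongrightarrow> h z"
    and L1: "(\<lambda>n. \<integral>z. norm (h z - s (r n) z) \<partial>torus) \<longlonglongrightarrow> 0"
    by (rule L1_Cauchy_limit[of torus s, OF s cauchy])
  have "(\<integral>z. h z * mode (- k) z \<partial>torus) = 0" for k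
  proof -
    obtain n0 where n0: "k \<in> A n0" using A_cover by blast
    \<comment> \<open>Once \<open>k\<close> belongs to the partial sum, the remainder has no
      coefficient at \<open>k\<close>, so that of \<open>h\<close> is bounded by the
      \<open>L\<^sup>1\<close> distance to the remainder.\<close>
    have "norm (\<integral>z. h z * mode (- k) z \<partial>torus) \<le> (\<integral>z. norm (h z - s (r n) z) \<partial>torus)" if "n \<ge> n0" for n
    proof -
      have "n0 \<le> r n" using seq_suble[OF r, of n] that by linarith
      then have kA: "k \<in> A (r n)" using A_mono n0 by blast
      have ti: "integrable torus (trig_sum (A (r n)) c)"
        by (intro integrable_torus continuous_intros)
      have "(\<integral>z. s (r n) z * mode (- k) z \<partial>torus)
        = (\<integral>z. f z * mode (- k) z \<partial>torus) - (\<integral>z. trig_sum (A (r n)) c z * mode (- k) z \<partial>torus)"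
        unfolding s_def left_diff_distrib
        using f ti by (intro Bochner_Integration.integral_diff integrable_torus_mult_mode)
      also have "\<dots> = 0"
        unfolding integral_trig_sum_mode[OF A] unfolding integral_mult_mode using kA by (simp add: c_def)
      finally have z: "(\<integral>z. s (r n) z * mode (- k) z \<partial>torus) = 0" .
      have "(\<integral>z. (h z - s (r n) z) * mode (- k) z \<partial>torus)
        = (\<integral>z. h z * mode (- k) z \<partial>torus) - (\<integral>z. s (r n) z * mode (- k) z \<partial>torus)"
        unfolding left_diff_distrib
        using h s by (intro Bochner_Integration.integral_diff integrable_torus_mult_mode)
      then have "norm (\<integral>z. h z * mode (- k) z \<partial>torus) = norm (\<integral>z. (h z - s (r n) z) * mode (- k) z \<partial>torus)"
        using z by simp
      also have "\<dots> \<le> (\<integral>z. norm ((h z - s (r n) z) * mode (- k) z) \<partial>torus)"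
        by (rule integral_norm_bound)
      finally show ?thesis by (simp add: norm_mult)
    qed
    then have "norm (\<integral>z. h z * mode (- k) z \<partial>torus) \<le> 0"
      by (intro LIMSEQ_le_const[OF L1]) auto
    then show ?thesis by simp
  qed
  \<comment> \<open>The sign change passes from \<open>mode (- k)\<close> to every
    \<open>mode k\<close>.\<close>
  from this[of "- _"] have "vanishing h"
    using h unfolding vanishing_def by simp
  then have "AE z in torus. h z = 0" by (rule vanishing_AE_zero)
  with lim have "AE z in torus. (\<lambda>n. trig_sum (A (r n)) c z) \<longlonglongrightarrow> f z"
  proof eventually_elim
    case (elim z)
    then have "(\<lambda>n. f z - s (r n) z) \<longlonglongrightarrow> f z - 0" by (intro tendsto_intros) simp
    then show ?case by (simp add: s_def)
  qed
  with A show thesis by (intro that[of "\<lambda>n. A (r n)"])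
qed

subsection \<open>The Strichartz estimate\<close>

definition strichartz_const :: real where
  "strichartz_const = (2 * pi)\<^sup>2 * (8 * (high_const + low_const))"

text \<open>The fourth power of the norm is the squared norm of the square, so Parseval leaves a
  convolution of coefficients, dominated by that of their absolute values.\<close>

lemma trig_sum_L4:
  assumes A: "finite A"
  shows "(\<integral>z. norm (trig_sum A c z) ^ 4 \<partial>torus)
    \<le> strichartz_const * (\<Sum>k\<in>A. modulation k powr (2/3) * (norm (c k))\<^sup>2)\<^sup>2"
proof -
  define a where "a = (\<lambda>i. if i \<in> A then norm (c i) else 0)"
  define P where "P = (\<lambda>(i, j). i + j) ` (A \<times> A)"
  \<comment> \<open>A rectangle containing all sums of two frequencies, as
    \<open>self_conv_bound\<close> is stated for products.\<close>
  define K where "K = fst ` P \<times> snd ` P"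
  define d where "d = (\<lambda>k. \<Sum>i\<in>A. if k - i \<in> A then c i * c (k - i) else 0)"
  have fin: "finite P" "finite K" using A by (auto simp: P_def K_def)
  have "i + j \<in> K" if "i \<in> A" "j \<in> A" for i j
  proof -
    have "i + j \<in> P" using that by (force simp: P_def)
    then show ?thesis unfolding K_def mem_Times_iff by blast
  qed
  then have sq: "(trig_sum A c z)\<^sup>2 = trig_sum K d z" for z
    unfolding d_def by (intro trig_sum_square A fin)
  have "norm (trig_sum A c z) ^ 4 = (norm ((trig_sum A c z)\<^sup>2))\<^sup>2" for z
    by (simp add: norm_power flip: power_mult)
  then have "(\<integral>z. norm (trig_sum A c z) ^ 4 \<partial>torus) = (2 * pi)\<^sup>2 * (\<Sum>k\<in>K. (norm (d k))\<^sup>2)"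
    by (simp only: sq parseval[OF fin(2)])
  also have "\<dots> \<le> (2 * pi)\<^sup>2 * (\<Sum>k\<in>K. (self_conv A a k)\<^sup>2)"
  proof (intro mult_left_mono sum_mono power_mono)
    fix k
    have "norm (d k) \<le> (\<Sum>i\<in>A. norm (if k - i \<in> A then c i * c (k - i) else 0))"
      unfolding d_def by (rule norm_sum)
    also have "\<dots> = self_conv A a k"
      unfolding self_conv_def by (intro sum.cong) (auto simp: a_def norm_mult)
    finally show "norm (d k) \<le> self_conv A a k" .
  qed auto
  also have "\<dots> \<le> (2 * pi)\<^sup>2 * (8 * (high_const + low_const) * (\<Sum>k\<in>A. modulation k powr (2/3) * (a k)\<^sup>2)\<^sup>2)"
    unfolding K_def using A fin by (intro mult_left_mono self_conv_bound) (auto simp: a_def)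
  also have "(\<Sum>k\<in>A. modulation k powr (2/3) * (a k)\<^sup>2) = (\<Sum>k\<in>A. modulation k powr (2/3) * (norm (c k))\<^sup>2)"
    by (simp add: a_def)
  finally show ?thesis by (simp add: strichartz_const_def mult.assoc)
qed

lemma strichartz_const_nonneg: "0 \<le> strichartz_const"
proof -
  have "0 \<le> high_const" using high_frequency_sum[of "{}"] by simp
  moreover have "0 \<le> low_const" unfolding low_const_def by (simp add: kernel_const_nonneg)
  ultimately show ?thesis by (simp add: strichartz_const_def)
qed

theorem theorem1p2:
  "\<exists>C::real. \<forall>f \<in> bourgain_space 0 (1 / 3).
     f \<in> Lp_space 4 \<and> Lp_norm 4 f \<le> C * bourgain_norm 0 (1 / 3) f"
\<comment> \<open>The constant stays schematic until the last \<open>show\<close>, which sets it to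
  \<open>strichartz_const powr (1 / 4)\<close>, independent of \<open>f\<close>.\<close>
proof (intro exI ballI)
  fix f assume f: "f \<in> bourgain_space 0 (1 / 3)"
  define c where "c = (\<lambda>k. fourier_coeff f (fst k) (snd k))"
  define w where "w = (\<lambda>k. modulation k powr (2/3) * (norm (c k))\<^sup>2)"
  define W where "W = infsum w UNIV"
  have b0: "bracket n powr (2 * 0) = 1" for n using bracket_pos[of n] by simp
  have w_eq: "(\<lambda>(n, \<tau>). bracket n powr (2 * 0) * (bracket (\<tau> - dispersion n) powr (2 * (1 / 3)) * (norm (fourier_coeff f n \<tau>))\<^sup>2)) = w"
    by (simp only: b0) (simp add: w_def modulation_def c_def fun_eq_iff)
  have int: "integrable torus f" and w: "w summable_on UNIV"
    using f unfolding bourgain_space_def by (auto simp only: w_eq mem_Collect_eq)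
  have w_nonneg: "0 \<le> w k" for k by (simp add: w_def)
  have "bourgain_norm 0 (1 / 3) f = sqrt (\<Sum>\<^sub>\<infinity>n. \<Sum>\<^sub>\<infinity>\<tau>. w (n, \<tau>))"
    unfolding bourgain_norm_def b0 by (simp add: w_def modulation_def c_def)
  \<comment> \<open>Summability over pairs merges the iterated sum into a single one, which
    dominates the energy of every partial Fourier sum.\<close>
  also have "(\<Sum>\<^sub>\<infinity>n. \<Sum>\<^sub>\<infinity>\<tau>. w (n, \<tau>)) = W"
    using infsum_Sigma_banach[of w UNIV "\<lambda>_. UNIV"] w by (simp add: W_def)
  finally have norm_eq: "bourgain_norm 0 (1 / 3) f = sqrt W" .
  have W: "0 \<le> W" unfolding W_def by (intro infsum_nonneg w_nonneg)
  have "(\<lambda>k. (norm (c k))\<^sup>2) summable_on UNIV"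
  proof (rule summable_on_comparison_test[OF w])
    fix k
    have "1 \<le> modulation k powr (2/3)" using modulation_ge_1[of k] by (intro ge_one_powr_ge_zero) auto
    then have "1 * (norm (c k))\<^sup>2 \<le> w k"
      unfolding w_def by (rule mult_right_mono) simp
    then show "(norm (c k))\<^sup>2 \<le> w k" by simp
  qed auto
  then obtain A where A: "\<And>n. finite (A n)" and lim: "AE z in torus. (\<lambda>n. trig_sum (A n) c z) \<longlonglongrightarrow> f z"
    using trig_sums_AE_converge[OF int] unfolding c_def by blast
  have "(\<integral>\<^sup>+z. ennreal (norm (f z) ^ 4) \<partial>torus) \<le> ennreal (strichartz_const * W\<^sup>2)"
  proof (rule nn_integral_AE_limit_le)
    show "AE z in torus. (\<lambda>n. ennreal (norm (trig_sum (A n) c z) ^ 4)) \<longlonglongrightarrow> ennreal (norm (f z) ^ 4)"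
      using lim by eventually_elim (intro tendsto_intros tendsto_ennrealI)
    have cont: "continuous_on UNIV (\<lambda>z. norm (trig_sum (A n) c z) ^ 4)" for n
      by (intro continuous_intros)
    show "(\<lambda>z. ennreal (norm (trig_sum (A n) c z) ^ 4)) \<in> borel_measurable torus" for n
      using measurable_torus[OF cont] by simp
    show "\<forall>\<^sub>F n in sequentially. (\<integral>\<^sup>+z. ennreal (norm (trig_sum (A n) c z) ^ 4) \<partial>torus) \<le> ennreal (strichartz_const * W\<^sup>2)"
    proof (intro always_eventually allI)
      fix n
      have "(\<integral>\<^sup>+z. ennreal (norm (trig_sum (A n) c z) ^ 4) \<partial>torus) = ennreal (\<integral>z. norm (trig_sum (A n) c z) ^ 4 \<partial>torus)"
        by (intro nn_integral_eq_integral integrable_torus cont) auto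
      also have "\<dots> \<le> ennreal (strichartz_const * (sum w (A n))\<^sup>2)"
        unfolding w_def by (intro ennreal_leI trig_sum_L4 A)
      also have "\<dots> \<le> ennreal (strichartz_const * W\<^sup>2)"
        unfolding W_def
        by (intro ennreal_leI mult_left_mono power_mono finite_sum_le_infsum w A sum_nonneg w_nonneg strichartz_const_nonneg) auto
      finally show "(\<integral>\<^sup>+z. ennreal (norm (trig_sum (A n) c z) ^ 4) \<partial>torus) \<le> ennreal (strichartz_const * W\<^sup>2)" .
    qed
  qed
  moreover have p4: "norm (f z) powr 4 = norm (f z) ^ 4" for z
    by (cases "f z = 0") (auto simp: powr_numeral)
  ultimately have le: "(\<integral>\<^sup>+z. ennreal (norm (f z) powr 4) \<partial>torus) \<le> ennreal (strichartz_const * W\<^sup>2)"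
    by simp
  have fm: "f \<in> borel_measurable torus" using int by simp
  \<comment> \<open>The Bochner integral of a nonintegrable function defaults to 0, so finiteness is
    established before the bound on \<open>Lp_norm\<close>.\<close>
  have i4: "integrable torus (\<lambda>z. norm (f z) powr 4)"
    using fm le by (intro integrableI_nonneg) (auto intro: le_less_trans)
  then have "f \<in> Lp_space 4" using fm by (simp add: Lp_space_def)
  have "ennreal (\<integral>z. norm (f z) powr 4 \<partial>torus) \<le> ennreal (strichartz_const * W\<^sup>2)"
    using le by (subst nn_integral_eq_integral[OF i4, symmetric]) auto
  then have "(\<integral>z. norm (f z) powr 4 \<partial>torus) \<le> strichartz_const * W\<^sup>2"
    using strichartz_const_nonneg by (subst (asm) ennreal_le_iff) auto
  then have "Lp_norm 4 f \<le> (strichartz_const * W\<^sup>2) powr (1 / 4)"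
    unfolding Lp_norm_def by (intro powr_mono2) auto
  also have "\<dots> = strichartz_const powr (1 / 4) * (W\<^sup>2) powr (1 / 4)"
    using strichartz_const_nonneg by (simp add: powr_mult)
  also have "(W\<^sup>2) powr (1 / 4) = sqrt W"
    using W by (cases "W = 0") (auto simp: powr_half_sqrt[symmetric] powr_powr simp flip: powr_numeral)
  finally show "f \<in> Lp_space 4 \<and> Lp_norm 4 f \<le> strichartz_const powr (1 / 4) * bourgain_norm 0 (1 / 3) f"
    using \<open>f \<in> Lp_space 4\<close> norm_eq by simp
qed

end
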